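(* Let $F$ be a field and let $G$ be a group acting primitively on a set $\Omega$ such that the permutation group $G^{\Omega}$ induced by $G$ on $\Omega$ is not cyclic. Then $\mathrm{LinDim}_F(G,\Omega)$ is the smallest codimension of a proper submodule of the permutation module $F^\Omega$ that is not a hyperplane. Moreover, if a witness for $\mathrm{LinDim}_F(G,\Omega)$ is reducible (as an $FG$-module), then it has a unique non-zero proper submodule $W$, and $W$ has codimension one.
   Context: A representation over $F$ of the action of $G$ on $\Omega$ is a pair $(\rho,\varphi)$ where, for some $F$-vector space $V$, $\rho:G\to \mathrm{GL}(V)$ is a homomorphism and $\varphi:\Omega\to V$ is an injective map such that $(\omega^g)\varphi=(\omega\varphi)^{g\rho}$ for all $\omega\in\Omega$, $g\in G$ (maps are written on the right, $\omega^g$ is the image of $\omega$ under $g$, and $v^{g\rho}$ is the image of $v$ under $g\rho$); one says $V$ affords $(\rho,\varphi)$, and $V$ is then an $FG$-module via $\rho$. $\mathrm{LinDim}_F(G,\Omega)$ is the minimum of $\dim V$ over all $V$ affording a representation of the action of $G$ on $\Omega$ over $F$. A witness is a $V$ affording such a representation with $\dim V=\mathrm{LinDim}_F(G,\Omega)$. The permutation module $F^\Omega$ is the $F$-vector space with basis $\{e_\omega\mid\omega\in\Omega\}$ and action $(e_\omega)^g=e_{\omega^g}$. A hyperplane is a subspace of codimension one. The action of $G$ on $\Omega$ is primitive if the only partitions of $\Omega$ preserved by $G$ are the partition with only one part and the partition into singletons.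
   Formalization: The "Moreover" is stated only when LinDim_F(G,Ω) is finite (automatic for finite Ω); it fails for infinite LinDim, e.g. G = Sym(ℕ) on ℕ with the reducible witness F^ℕ ⊕ F^ℕ, n ↦ (e_n, e_n), which has several non-zero proper submodules. *)

theory Defs
  imports "HOL-Algebra.Group_Action" "HOL-Algebra.Elementary_Groups" "HOL-Algebra.AbelCoset"
    "HOL-Library.Disjoint_Sets" "Jordan_Normal_Form.Missing_VectorSpace"
begin

unbundle cardinal_syntax

text \<open>
  Actions are given by \<^locale>\<open>group_action\<close>, i.e. by a homomorphism \<open>act\<close> from \<open>G\<close> to
  \<open>BijGroup \<Omega>\<close>; maps are written on the left. Dimensions are cardinal numbers, represented as
  in the library by the canonical well-orders \<open>|A|\<close> and compared by \<open>=o\<close>, \<open>\<le>o\<close>, \<open><o\<close>, because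
  \<open>\<Omega>\<close> may be infinite.
\<close>

section \<open>Primitive actions and induced permutation groups\<close>

definition primitive_action ::
    "('g, 'm) monoid_scheme \<Rightarrow> 'w set \<Rightarrow> ('g \<Rightarrow> 'w \<Rightarrow> 'w) \<Rightarrow> bool" where
  "primitive_action G \<Omega> act \<longleftrightarrow>
     (\<forall>P. partition_on \<Omega> P \<and> (\<forall>g\<in>carrier G. \<forall>A\<in>P. act g ` A \<in> P) \<longrightarrow>
          P = {\<Omega>} \<or> P = {{\<omega>} | \<omega>. \<omega> \<in> \<Omega>})"

definition induced_group ::
    "('g, 'm) monoid_scheme \<Rightarrow> 'w set \<Rightarrow> ('g \<Rightarrow> 'w \<Rightarrow> 'w) \<Rightarrow> ('w \<Rightarrow> 'w) monoid" where
  "induced_group G \<Omega> act = (BijGroup \<Omega>)\<lparr>carrier := act ` carrier G\<rparr>"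

section \<open>Dimension and codimension\<close>

text \<open>
  The library's \<^const>\<open>vectorspace.dim\<close> is a natural number that is meaningful only for
  finite-dimensional spaces, hence this cardinal-valued version.
\<close>

definition vdim :: "('f, 'r) ring_scheme \<Rightarrow> ('f, 'v, 's) module_scheme \<Rightarrow> 'v rel" where
  "vdim F V = |SOME B. vectorspace.basis F V B|"

definition quotient_space :: "('f, 'v, 's) module_scheme \<Rightarrow> 'v set \<Rightarrow> ('f, 'v set) module" where
  "quotient_space V W =
     \<lparr>carrier = a_rcosets\<^bsub>V\<^esub> W,
      mult = undefined, one = undefined,
      zero = W,
      add = (\<lambda>X Y. X <+>\<^bsub>V\<^esub> Y),
      smult = (\<lambda>a X. \<Union>x\<in>X. W +>\<^bsub>V\<^esub> (a \<odot>\<^bsub>V\<^esub> x))\<rparr>"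
    \<comment> \<open>\<open>mult\<close> and \<open>one\<close> are record fields that play no role for modules.\<close>

definition codim :: "('f, 'r) ring_scheme \<Rightarrow> ('f, 'v, 's) module_scheme \<Rightarrow> 'v set \<Rightarrow> 'v set rel" where
  "codim F V W = vdim F (quotient_space V W)"

definition hyperplane :: "('f, 'r) ring_scheme \<Rightarrow> ('f, 'v, 's) module_scheme \<Rightarrow> 'v set \<Rightarrow> bool" where
  "hyperplane F V W \<longleftrightarrow> submodule F W V \<and> codim F V W =o cone"

section \<open>Linear representations of actions\<close>

definition GL :: "('f, 'r) ring_scheme \<Rightarrow> ('f, 'v, 's) module_scheme \<Rightarrow> ('v \<Rightarrow> 'v) monoid" where
  "GL F V = (BijGroup (carrier V))\<lparr>carrier := Bij (carrier V) \<inter> module_hom F V V\<rparr>"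

definition action_rep ::
    "('f, 'r) ring_scheme \<Rightarrow> ('g, 'm) monoid_scheme \<Rightarrow> 'w set \<Rightarrow> ('g \<Rightarrow> 'w \<Rightarrow> 'w) \<Rightarrow>
     ('f, 'v, 's) module_scheme \<Rightarrow> ('g \<Rightarrow> 'v \<Rightarrow> 'v) \<Rightarrow> ('w \<Rightarrow> 'v) \<Rightarrow> bool" where
  "action_rep F G \<Omega> act V \<rho> \<phi> \<longleftrightarrow>
     vectorspace F V \<and> \<rho> \<in> hom G (GL F V) \<and> \<phi> \<in> \<Omega> \<rightarrow> carrier V \<and> inj_on \<phi> \<Omega> \<and>
     (\<forall>g\<in>carrier G. \<forall>\<omega>\<in>\<Omega>. \<phi> (act g \<omega>) = \<rho> g (\<phi> \<omega>))"

definition affords ::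
    "('f, 'r) ring_scheme \<Rightarrow> ('g, 'm) monoid_scheme \<Rightarrow> 'w set \<Rightarrow> ('g \<Rightarrow> 'w \<Rightarrow> 'w) \<Rightarrow>
     ('f, 'v, 's) module_scheme \<Rightarrow> bool" where
  "affords F G \<Omega> act V \<longleftrightarrow> (\<exists>\<rho> \<phi>. action_rep F G \<Omega> act V \<rho> \<phi>)"

definition is_min_card :: "'a rel \<Rightarrow> 'b rel set \<Rightarrow> bool" where
  "is_min_card \<kappa> K \<longleftrightarrow> (\<exists>\<mu>\<in>K. \<kappa> =o \<mu>) \<and> (\<forall>\<mu>\<in>K. \<kappa> \<le>o \<mu>)"

text \<open>
  HOL cannot quantify over all types of vectors inside a definition, so \<open>V\<close> ranges over the spaces
  whose vectors are of type \<open>('w \<Rightarrow> 'f) set\<close>. Nothing is lost: if \<open>V\<close> affords a representation, so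
  does the span of the image of \<open>\<phi>\<close>, which is isomorphic to a quotient of the permutation module,
  and the elements of such a quotient are sets of functions \<open>\<Omega> \<rightarrow> F\<close>. The value is determined up
  to \<open>=o\<close>.
\<close>

definition LinDim ::
    "('f, 'r) ring_scheme \<Rightarrow> ('g, 'm) monoid_scheme \<Rightarrow> 'w set \<Rightarrow> ('g \<Rightarrow> 'w \<Rightarrow> 'w) \<Rightarrow>
     ('w \<Rightarrow> 'f) set rel" where
  "LinDim F G \<Omega> act =
     (SOME \<kappa>. is_min_card \<kappa> {vdim F V | V :: ('f, ('w \<Rightarrow> 'f) set) module. affords F G \<Omega> act V})"

definition witness ::
    "('f, 'r) ring_scheme \<Rightarrow> ('g, 'm) monoid_scheme \<Rightarrow> 'w set \<Rightarrow> ('g \<Rightarrow> 'w \<Rightarrow> 'w) \<Rightarrow>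
     ('f, 'v, 's) module_scheme \<Rightarrow> ('g \<Rightarrow> 'v \<Rightarrow> 'v) \<Rightarrow> ('w \<Rightarrow> 'v) \<Rightarrow> bool" where
  "witness F G \<Omega> act V \<rho> \<phi> \<longleftrightarrow> action_rep F G \<Omega> act V \<rho> \<phi> \<and> vdim F V =o LinDim F G \<Omega> act"

section \<open>Submodules for the group, and the permutation module\<close>

definition FG_submodule ::
    "('f, 'r) ring_scheme \<Rightarrow> ('g, 'm) monoid_scheme \<Rightarrow> ('f, 'v, 's) module_scheme \<Rightarrow>
     ('g \<Rightarrow> 'v \<Rightarrow> 'v) \<Rightarrow> 'v set \<Rightarrow> bool" where
  "FG_submodule F G V \<rho> W \<longleftrightarrow> submodule F W V \<and> (\<forall>g\<in>carrier G. \<forall>w\<in>W. \<rho> g w \<in> W)"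

definition nonzero_proper_FG_submodule ::
    "('f, 'r) ring_scheme \<Rightarrow> ('g, 'm) monoid_scheme \<Rightarrow> ('f, 'v, 's) module_scheme \<Rightarrow>
     ('g \<Rightarrow> 'v \<Rightarrow> 'v) \<Rightarrow> 'v set \<Rightarrow> bool" where
  "nonzero_proper_FG_submodule F G V \<rho> W \<longleftrightarrow>
     FG_submodule F G V \<rho> W \<and> W \<noteq> {\<zero>\<^bsub>V\<^esub>} \<and> W \<noteq> carrier V"

definition reducible ::
    "('f, 'r) ring_scheme \<Rightarrow> ('g, 'm) monoid_scheme \<Rightarrow> ('f, 'v, 's) module_scheme \<Rightarrow>
     ('g \<Rightarrow> 'v \<Rightarrow> 'v) \<Rightarrow> bool" where
  "reducible F G V \<rho> \<longleftrightarrow> (\<exists>W. nonzero_proper_FG_submodule F G V \<rho> W)"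

text \<open>\<open>F\<^sup>\<Omega>\<close> is the space of finitely supported functions \<open>\<Omega> \<rightarrow> F\<close>, i.e. of the formal finite sums
  of the basis vectors \<open>e\<^sub>\<omega>\<close>.\<close>

definition perm_module :: "('f, 'r) ring_scheme \<Rightarrow> 'w set \<Rightarrow> ('f, 'w \<Rightarrow> 'f) module" where
  "perm_module F \<Omega> = (ring.func_space F \<Omega>)
     \<lparr>carrier := {f \<in> \<Omega> \<rightarrow>\<^sub>E carrier F. finite {\<omega>\<in>\<Omega>. f \<omega> \<noteq> \<zero>\<^bsub>F\<^esub>}}\<rparr>"

definition perm_unit :: "('f, 'r) ring_scheme \<Rightarrow> 'w set \<Rightarrow> 'w \<Rightarrow> 'w \<Rightarrow> 'f" where
  "perm_unit F \<Omega> \<omega> = (\<lambda>x\<in>\<Omega>. if x = \<omega> then \<one>\<^bsub>F\<^esub> else \<zero>\<^bsub>F\<^esub>)"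

definition perm_rep ::
    "('f, 'r) ring_scheme \<Rightarrow> ('g, 'm) monoid_scheme \<Rightarrow> 'w set \<Rightarrow> ('g \<Rightarrow> 'w \<Rightarrow> 'w) \<Rightarrow>
     'g \<Rightarrow> ('w \<Rightarrow> 'f) \<Rightarrow> 'w \<Rightarrow> 'f" where
  "perm_rep F G \<Omega> act g = (\<lambda>f\<in>carrier (perm_module F \<Omega>). \<lambda>\<omega>\<in>\<Omega>. f (act (inv\<^bsub>G\<^esub> g) \<omega>))"

text \<open>Consistency of the encodings: \<open>perm_rep\<close> is the action \<open>e\<^sub>\<omega> \<mapsto> e\<^bsub>act g \<omega>\<^esub>\<close>, it is a representation
  of the action of \<open>G\<close> on \<open>\<Omega>\<close>, and quotients by subspaces are vector spaces.\<close>

lemma perm_module_simps: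
  assumes "field F"
  shows "carrier (perm_module F \<Omega>) = {f \<in> \<Omega> \<rightarrow>\<^sub>E carrier F. finite {\<omega>\<in>\<Omega>. f \<omega> \<noteq> \<zero>\<^bsub>F\<^esub>}}"
    "\<zero>\<^bsub>perm_module F \<Omega>\<^esub> = (\<lambda>\<omega>\<in>\<Omega>. \<zero>\<^bsub>F\<^esub>)"
    "f \<oplus>\<^bsub>perm_module F \<Omega>\<^esub> h = (\<lambda>\<omega>\<in>\<Omega>. f \<omega> \<oplus>\<^bsub>F\<^esub> h \<omega>)"
    "a \<odot>\<^bsub>perm_module F \<Omega>\<^esub> f = (\<lambda>\<omega>\<in>\<Omega>. a \<otimes>\<^bsub>F\<^esub> f \<omega>)"
proof -
  interpret field F by fact
  show "carrier (perm_module F \<Omega>) = {f \<in> \<Omega> \<rightarrow>\<^sub>E carrier F. finite {\<omega>\<in>\<Omega>. f \<omega> \<noteq> \<zero>\<^bsub>F\<^esub>}}"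
    "\<zero>\<^bsub>perm_module F \<Omega>\<^esub> = (\<lambda>\<omega>\<in>\<Omega>. \<zero>\<^bsub>F\<^esub>)"
    "f \<oplus>\<^bsub>perm_module F \<Omega>\<^esub> h = (\<lambda>\<omega>\<in>\<Omega>. f \<omega> \<oplus>\<^bsub>F\<^esub> h \<omega>)"
    "a \<odot>\<^bsub>perm_module F \<Omega>\<^esub> f = (\<lambda>\<omega>\<in>\<Omega>. a \<otimes>\<^bsub>F\<^esub> f \<omega>)"
    by (simp_all add: perm_module_def func_space_def)
qed

lemma vectorspace_perm_module:
  assumes "field F"
  shows "vectorspace F (perm_module F \<Omega>)"
proof -
  interpret field F by fact
  note S = perm_module_simps[OF assms]
  have sub: "submodule F (carrier (perm_module F \<Omega>)) (func_space \<Omega>)"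
  proof (rule LinearCombinations.submodule.intro)
    show "module F (func_space \<Omega>)" by (rule func_space_is_module)
    show "carrier (perm_module F \<Omega>) \<subseteq> carrier (func_space \<Omega>)"
      by (auto simp: S func_space_def)
    fix f h assume "f \<in> carrier (perm_module F \<Omega>)" "h \<in> carrier (perm_module F \<Omega>)"
    moreover have "{\<omega>\<in>\<Omega>. f \<omega> \<oplus>\<^bsub>F\<^esub> h \<omega> \<noteq> \<zero>\<^bsub>F\<^esub>} \<subseteq> {\<omega>\<in>\<Omega>. f \<omega> \<noteq> \<zero>\<^bsub>F\<^esub>} \<union> {\<omega>\<in>\<Omega>. h \<omega> \<noteq> \<zero>\<^bsub>F\<^esub>}"
      by auto
    ultimately show "f \<oplus>\<^bsub>func_space \<Omega>\<^esub> h \<in> carrier (perm_module F \<Omega>)"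
      by (auto simp: S func_space_def PiE_iff intro: finite_subset cong: conj_cong)
  next
    show "\<zero>\<^bsub>func_space \<Omega>\<^esub> \<in> carrier (perm_module F \<Omega>)"
      by (auto simp: S func_space_def cong: conj_cong)
    fix c f assume "c \<in> carrier F" "f \<in> carrier (perm_module F \<Omega>)"
    moreover then have "{\<omega>\<in>\<Omega>. c \<otimes>\<^bsub>F\<^esub> f \<omega> \<noteq> \<zero>\<^bsub>F\<^esub>} \<subseteq> {\<omega>\<in>\<Omega>. f \<omega> \<noteq> \<zero>\<^bsub>F\<^esub>}" by auto
    ultimately show "c \<odot>\<^bsub>func_space \<Omega>\<^esub> f \<in> carrier (perm_module F \<Omega>)"
      by (auto simp: S func_space_def PiE_iff intro: finite_subset cong: conj_cong)
  qed
  have "module F (perm_module F \<Omega>)"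
    using module.submodule_is_module[OF func_space_is_module sub]
    by (simp add: perm_module_def)
  then show ?thesis using assms by (simp add: vectorspace_def)
qed

lemma perm_rep_perm_unit:
  assumes "field F" "group G" "group_action G \<Omega> act" "g \<in> carrier G" "\<omega> \<in> \<Omega>"
  shows "perm_unit F \<Omega> \<omega> \<in> carrier (perm_module F \<Omega>)"
    "perm_rep F G \<Omega> act g (perm_unit F \<Omega> \<omega>) = perm_unit F \<Omega> (act g \<omega>)"
proof -
  interpret field F by fact
  interpret A: group_action G \<Omega> act by fact
  interpret G: group G by fact
  show 1: "perm_unit F \<Omega> \<omega> \<in> carrier (perm_module F \<Omega>)"
    by (auto simp: perm_module_simps[OF assms(1)] perm_unit_def cong: conj_cong)
  have "act (inv\<^bsub>G\<^esub> g) x = \<omega> \<longleftrightarrow> x = act g \<omega>" if "x \<in> \<Omega>" for x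
    using that assms A.orbit_sym_aux
    by (metis A.element_image G.inv_closed G.inv_inv)
  moreover have "act (inv\<^bsub>G\<^esub> g) x \<in> \<Omega>" if "x \<in> \<Omega>" for x
    using that assms A.element_image by blast
  ultimately show "perm_rep F G \<Omega> act g (perm_unit F \<Omega> \<omega>) = perm_unit F \<Omega> (act g \<omega>)"
    using 1 by (auto simp: perm_rep_def perm_unit_def restrict_def fun_eq_iff)
qed

lemma perm_rep_closed:
  assumes "field F" "group G" "group_action G \<Omega> act" "g \<in> carrier G" "f \<in> carrier (perm_module F \<Omega>)"
  shows "perm_rep F G \<Omega> act g f \<in> carrier (perm_module F \<Omega>)"
proof -
  interpret A: group_action G \<Omega> act by fact
  interpret G: group G by fact
  have c: "act (inv\<^bsub>G\<^esub> g) x \<in> \<Omega>" if "x \<in> \<Omega>" for x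
    using that assms A.element_image by blast
  have "{\<omega>\<in>\<Omega>. f (act (inv\<^bsub>G\<^esub> g) \<omega>) \<noteq> \<zero>\<^bsub>F\<^esub>} \<subseteq> act g ` {\<omega>\<in>\<Omega>. f \<omega> \<noteq> \<zero>\<^bsub>F\<^esub>}"
  proof
    fix x assume x: "x \<in> {\<omega>\<in>\<Omega>. f (act (inv\<^bsub>G\<^esub> g) \<omega>) \<noteq> \<zero>\<^bsub>F\<^esub>}"
    then have "act g (act (inv\<^bsub>G\<^esub> g) x) = x"
      using A.orbit_sym_aux[of "inv\<^bsub>G\<^esub> g" x] assms by simp
    then show "x \<in> act g ` {\<omega>\<in>\<Omega>. f \<omega> \<noteq> \<zero>\<^bsub>F\<^esub>}" using x c
      by (metis (no_types, lifting) image_eqI mem_Collect_eq)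
  qed
  moreover have "finite {\<omega>\<in>\<Omega>. f \<omega> \<noteq> \<zero>\<^bsub>F\<^esub>}" using assms(5) by (simp add: perm_module_simps[OF assms(1)])
  ultimately have "finite {\<omega>\<in>\<Omega>. f (act (inv\<^bsub>G\<^esub> g) \<omega>) \<noteq> \<zero>\<^bsub>F\<^esub>}"
    by (meson finite_imageI finite_subset)
  then show ?thesis using assms(5) c
    by (auto simp: perm_rep_def perm_module_simps[OF assms(1)] cong: conj_cong)
qed

lemma action_rep_perm_module:
  assumes "field F" "group G" "group_action G \<Omega> act"
  shows "action_rep F G \<Omega> act (perm_module F \<Omega>) (perm_rep F G \<Omega> act) (perm_unit F \<Omega>)"
proof -
  interpret field F by fact
  interpret A: group_action G \<Omega> act by fact
  interpret G: group G by fact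
  let ?P = "perm_module F \<Omega>" and ?r = "perm_rep F G \<Omega> act"
  note S = perm_module_simps[OF assms(1)]
  have c: "act g x \<in> \<Omega>" if "x \<in> \<Omega>" "g \<in> carrier G" for g x
    using that A.element_image by blast
  note cl = perm_rep_closed[OF assms]
  have comp: "?r (g \<otimes>\<^bsub>G\<^esub> h) f = ?r g (?r h f)" 
    if "g \<in> carrier G" "h \<in> carrier G" "f \<in> carrier ?P" for g h f
    using that cl[of h f] c
    by (auto simp: perm_rep_def fun_eq_iff G.inv_mult_group A.composition_rule restrict_def)
  have one: "?r \<one>\<^bsub>G\<^esub> f = f" if "f \<in> carrier ?P" for f
  proof -
    have "act \<one>\<^bsub>G\<^esub> x = x" if "x \<in> \<Omega>" for x
      using A.id_eq_one that by (metis restrict_apply')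
    then show ?thesis using that
      by (auto simp: perm_rep_def fun_eq_iff restrict_def S PiE_iff extensional_def)
  qed
  have bij: "?r g \<in> Bij (carrier ?P)" if "g \<in> carrier G" for g
  proof -
    have "bij_betw (?r g) (carrier ?P) (carrier ?P)"
      by (rule bij_betw_byWitness[where f'="?r (inv\<^bsub>G\<^esub> g)"])
        (use that comp[symmetric] one cl in auto)
    then show ?thesis by (auto simp: Bij_def perm_rep_def)
  qed
  have lin: "?r g \<in> module_hom F ?P ?P" if "g \<in> carrier G" for g
  proof -
    interpret P: vectorspace F ?P by (rule vectorspace_perm_module) fact
    have a: "f \<oplus>\<^bsub>?P\<^esub> h \<in> carrier ?P" if "f \<in> carrier ?P" "h \<in> carrier ?P" for f h
      using that by (rule P.M.a_closed)
    have s: "k \<odot>\<^bsub>?P\<^esub> h \<in> carrier ?P" if "k \<in> carrier F" "h \<in> carrier ?P" for k h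
      using that by (rule P.smult_closed)
    show ?thesis
      unfolding module_hom_def
      using that cl a s c
      by (auto simp: perm_rep_def S(3,4) fun_eq_iff restrict_def)
  qed
  have "?r \<in> hom G (GL F ?P)"
  proof (rule homI)
    fix g h assume g: "g \<in> carrier G" "h \<in> carrier G"
    have "?r (g \<otimes>\<^bsub>G\<^esub> h) = compose (carrier ?P) (?r g) (?r h)"
      using comp[OF g] by (auto simp: compose_def fun_eq_iff restrict_def perm_rep_def)
    then show "?r (g \<otimes>\<^bsub>G\<^esub> h) = ?r g \<otimes>\<^bsub>GL F ?P\<^esub> ?r h"
      using bij g by (simp add: GL_def BijGroup_def)
  qed (use bij lin in \<open>simp add: GL_def BijGroup_def\<close>)
  moreover have "inj_on (perm_unit F \<Omega>) \<Omega>"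
  proof (rule inj_onI)
    fix x y assume "x \<in> \<Omega>" "y \<in> \<Omega>" "perm_unit F \<Omega> x = perm_unit F \<Omega> y"
    then have "perm_unit F \<Omega> y x = perm_unit F \<Omega> x x" by simp
    then show "x = y" using \<open>x \<in> \<Omega>\<close> one_not_zero by (auto simp: perm_unit_def split: if_splits)
  qed
  ultimately show ?thesis
    unfolding action_rep_def
    using perm_rep_perm_unit(1)[OF assms G.one_closed] perm_rep_perm_unit(2)[OF assms]
      vectorspace_perm_module[OF assms(1)]
    by (intro conjI ballI funcsetI) simp_all
qed

lemma vectorspace_quotient_space:
  assumes "vectorspace F V" "submodule F W V"
  shows "vectorspace F (quotient_space V W)"
proof -
  interpret V: vectorspace F V by fact
  have add: "additive_subgroup W V"
  proof -
    have W: "W \<subseteq> carrier V" "\<zero>\<^bsub>V\<^esub> \<in> W" "\<And>x y. x \<in> W \<Longrightarrow> y \<in> W \<Longrightarrow> x \<oplus>\<^bsub>V\<^esub> y \<in> W"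
      "\<And>a x. a \<in> carrier F \<Longrightarrow> x \<in> W \<Longrightarrow> a \<odot>\<^bsub>V\<^esub> x \<in> W"
      using assms(2) unfolding submodule_def by auto
    have "\<ominus>\<^bsub>V\<^esub> x \<in> W" if "x \<in> W" for x
      using that W by (metis V.R.a_inv_closed V.R.one_closed V.smult_minus_1_back subsetD)
    with W(1-3) show ?thesis
      by (intro additive_subgroupI subgroup.intro) (auto simp: a_inv_def)
  qed
  interpret W: abelian_subgroup W V
    using add by (intro abelian_subgroupI3) (auto intro: V.M.abelian_group_axioms)
  have sm: "a \<odot>\<^bsub>V\<^esub> w \<in> W" if "a \<in> carrier F" "w \<in> W" for a w
    using assms(2) that unfolding submodule_def by auto
  have Wc: "W \<subseteq> carrier V" by (rule W.a_subset)
  let ?Q = "quotient_space V W"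
  have smult: "a \<odot>\<^bsub>?Q\<^esub> (W +>\<^bsub>V\<^esub> x) = W +>\<^bsub>V\<^esub> (a \<odot>\<^bsub>V\<^esub> x)" if "a \<in> carrier F" "x \<in> carrier V" for a x
  proof -
    have "W +>\<^bsub>V\<^esub> (a \<odot>\<^bsub>V\<^esub> y) = W +>\<^bsub>V\<^esub> (a \<odot>\<^bsub>V\<^esub> x)" if y: "y \<in> W +>\<^bsub>V\<^esub> x" for y
    proof -
      obtain w where w: "w \<in> W" "y = w \<oplus>\<^bsub>V\<^esub> x" using y by (auto simp: a_r_coset_def' )
      then have "a \<odot>\<^bsub>V\<^esub> y = a \<odot>\<^bsub>V\<^esub> w \<oplus>\<^bsub>V\<^esub> a \<odot>\<^bsub>V\<^esub> x"
        using Wc \<open>a \<in> carrier F\<close> \<open>x \<in> carrier V\<close> by (auto simp: V.smult_r_distr)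
      then have "a \<odot>\<^bsub>V\<^esub> y \<in> W +>\<^bsub>V\<^esub> (a \<odot>\<^bsub>V\<^esub> x)" using sm w \<open>a \<in> carrier F\<close> by (auto simp: a_r_coset_def')
      then show ?thesis using W.a_repr_independence' V.smult_closed \<open>a \<in> carrier F\<close> \<open>x \<in> carrier V\<close> by metis
    qed
    moreover have "x \<in> W +>\<^bsub>V\<^esub> x" using that W.a_rcos_self by blast
    ultimately have "(\<Union>y\<in>W +>\<^bsub>V\<^esub> x. W +>\<^bsub>V\<^esub> (a \<odot>\<^bsub>V\<^esub> y)) = W +>\<^bsub>V\<^esub> (a \<odot>\<^bsub>V\<^esub> x)"
      by (intro UN_constant_eq) blast+
    then show ?thesis by (simp only: quotient_space_def module.simps)
  qed
  have Q: "carrier ?Q = a_rcosets\<^bsub>V\<^esub> W" "X \<oplus>\<^bsub>?Q\<^esub> Y = X <+>\<^bsub>V\<^esub> Y" "\<zero>\<^bsub>?Q\<^esub> = W" for X Y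
    by (simp_all add: quotient_space_def)
  have ex: "\<exists>x\<in>carrier V. X = W +>\<^bsub>V\<^esub> x" if "X \<in> carrier ?Q" for X
    using that by (auto simp: Q A_RCOSETS_def')
  have inQ: "W +>\<^bsub>V\<^esub> x \<in> carrier ?Q" if "x \<in> carrier V" for x
    using that by (auto simp: Q A_RCOSETS_def')
  have sum: "(W +>\<^bsub>V\<^esub> x) \<oplus>\<^bsub>?Q\<^esub> (W +>\<^bsub>V\<^esub> y) = W +>\<^bsub>V\<^esub> (x \<oplus>\<^bsub>V\<^esub> y)" if "x \<in> carrier V" "y \<in> carrier V" for x y
    using that by (simp add: Q W.a_rcos_sum)
  have z: "\<zero>\<^bsub>?Q\<^esub> = W +>\<^bsub>V\<^esub> \<zero>\<^bsub>V\<^esub>" using Wc by (simp add: Q)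
  have "abelian_group ?Q"
  proof (rule abelian_groupI)
    fix X assume "X \<in> carrier ?Q"
    then obtain x where x: "x \<in> carrier V" "X = W +>\<^bsub>V\<^esub> x" using ex by blast
    show "\<zero>\<^bsub>?Q\<^esub> \<oplus>\<^bsub>?Q\<^esub> X = X" using x by (simp add: z sum)
    show "\<exists>Y\<in>carrier ?Q. Y \<oplus>\<^bsub>?Q\<^esub> X = \<zero>\<^bsub>?Q\<^esub>"
      by (rule bexI[of _ "W +>\<^bsub>V\<^esub> (\<ominus>\<^bsub>V\<^esub> x)"]) (use x in \<open>auto simp: z sum inQ V.M.l_neg\<close>)
  qed (auto dest!: ex simp: sum z inQ V.M.a_ac)
  moreover have "cring F" by (rule V.R.is_cring)
  ultimately have "module F ?Q"
  proof (intro moduleI)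
    fix a b X Y assume a: "a \<in> carrier F" and b: "b \<in> carrier F"
      and "X \<in> carrier ?Q" "Y \<in> carrier ?Q"
    then obtain x y where x: "x \<in> carrier V" "X = W +>\<^bsub>V\<^esub> x" and y: "y \<in> carrier V" "Y = W +>\<^bsub>V\<^esub> y"
      using ex by meson
    show "(a \<oplus>\<^bsub>F\<^esub> b) \<odot>\<^bsub>?Q\<^esub> X = a \<odot>\<^bsub>?Q\<^esub> X \<oplus>\<^bsub>?Q\<^esub> b \<odot>\<^bsub>?Q\<^esub> X"
      using a b x by (simp add: smult sum V.smult_l_distr)
    show "a \<odot>\<^bsub>?Q\<^esub> (X \<oplus>\<^bsub>?Q\<^esub> Y) = a \<odot>\<^bsub>?Q\<^esub> X \<oplus>\<^bsub>?Q\<^esub> a \<odot>\<^bsub>?Q\<^esub> Y"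
      using a x y by (simp add: smult sum V.smult_r_distr)
    show "a \<otimes>\<^bsub>F\<^esub> b \<odot>\<^bsub>?Q\<^esub> X = a \<odot>\<^bsub>?Q\<^esub> (b \<odot>\<^bsub>?Q\<^esub> X)"
      using a b x by (simp add: smult V.smult_assoc1)
  next
    fix a X assume "a \<in> carrier F" "X \<in> carrier ?Q"
    then show "a \<odot>\<^bsub>?Q\<^esub> X \<in> carrier ?Q" using ex smult inQ by (metis V.smult_closed)
  next
    fix X assume "X \<in> carrier ?Q"
    then show "\<one>\<^bsub>F\<^esub> \<odot>\<^bsub>?Q\<^esub> X = X" using ex smult by (metis V.smult_one V.R.one_closed)
  qed
  then show ?thesis using V.field_axioms by (simp add: vectorspace_def)
qed
end

theory Submission
  imports Defs "HOL-Algebra.Free_Abelian_Groups"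
begin

text \<open>
  Why the theorem holds. Let \<open>V\<close> afford a representation \<open>(\<rho>, \<phi>)\<close> of the action. The linear
  extension \<open>e\<^sub>\<omega> \<mapsto> \<phi> \<omega>\<close> is an equivariant map from the permutation module to \<open>V\<close>; its kernel \<open>U\<close> is a
  proper submodule of codimension at most \<open>dim V\<close>. It is not a hyperplane: on a one-dimensional space
  the group would act by scalars, so the induced permutation group would be abelian, and a primitive
  abelian permutation group is cyclic (\<open>primitive_not_cyclic_imp_not_commuting\<close>,
  \<open>not_one_dimensional_rep\<close>, \<open>exists_admissible_kernel\<close>).

  Conversely let \<open>U\<close> be a proper submodule that is not a hyperplane. The fibres of \<open>\<omega> \<mapsto> e\<^sub>\<omega> + U\<close> form an
  invariant partition of \<open>\<Omega>\<close>, so by primitivity this map is injective or constant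
  (\<open>primitive_quotient_dichotomy\<close>). If it were constant, then the quotient would be spanned by a single
  vector and \<open>U\<close> would be a hyperplane. So it is injective, and the quotient by \<open>U\<close> affords the action
  (\<open>admissible_quotient_affords\<close>). Both constructions together show that the two minima agree.

  Now let \<open>V\<close> be a witness of finite dimension. By minimality \<open>V\<close> is spanned by the image of \<open>\<phi>\<close>, and for
  a non-zero proper submodule \<open>W\<close> the smaller quotient \<open>V / W\<close> cannot afford the action. By the same
  dichotomy all vectors \<open>\<phi> \<omega>\<close> are congruent modulo \<open>W\<close>, which makes \<open>V / W\<close> a line. All submodules of
  this kind have these congruences in common, and this forces any two of them to coincide
  (\<open>witness_submodule_subset\<close>).

  Since \<open>\<Omega>\<close> may be infinite, the argument uses dimension as a cardinal number. It depends on the existence of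
  bases, on the invariance of their cardinality, and on the comparison of \<open>V\<close> with a space \<open>Q\<close> along two maps
  from a common source (\<open>vdim_le_of_ker_le\<close>, \<open>vdim_less_of_ker_le\<close>).
\<close>

section \<open>Bases and dimension of arbitrary vector spaces\<close>

text \<open>
  Zorn's lemma: a linear dependence involves only finitely many vectors, so the union of a chain of
  linearly independent sets is linearly independent, and a maximal such set is a basis.
\<close>

lemma (in vectorspace) exists_basis: "\<exists>B. basis B"
proof -
  let ?A = "{S. S \<subseteq> carrier V \<and> lin_indpt S}"
  have "\<exists>M\<in>?A. \<forall>X\<in>?A. M \<subseteq> X \<longrightarrow> X = M"
  proof (rule subset_Zorn')
    fix C assume C: "subset.chain ?A C"
    have "lin_indpt (\<Union>C)"
    proof
      assume "lin_dep (\<Union>C)"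
      then obtain A a v where A: "finite A" "A \<subseteq> \<Union>C" "a \<in> A \<rightarrow> carrier K" "lincomb a A = \<zero>\<^bsub>V\<^esub>"
        "v \<in> A" "a v \<noteq> \<zero>\<^bsub>K\<^esub>"
        unfolding lin_dep_def by blast
      have "C \<noteq> {}" using A by auto
      then obtain S where "S \<in> C" "A \<subseteq> S"
        using finite_subset_Union_chain[OF A(1,2) _ C] by blast
      then have "lin_dep S" using lin_dep_crit A by metis
      then show False using C \<open>S \<in> C\<close> by (auto simp: subset_chain_def)
    qed
    then show "\<Union>C \<in> ?A" using C by (auto simp: subset_chain_def)
  qed
  then obtain M where "M \<in> ?A" "\<forall>X\<in>?A. M \<subseteq> X \<longrightarrow> X = M" ..
  then have "maximal M (\<lambda>S. S \<subseteq> carrier V \<and> lin_indpt S)"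
    by (auto simp: maximal_def)
  then show ?thesis using max_li_is_basis by blast
qed

text \<open>
  Otherwise Steinitz exchange, applied to \<open>card S + 1\<close> vectors of \<open>L\<close>, would produce a complement of
  negative size.
\<close>

lemma (in vectorspace) lin_indpt_in_finite_span:
  assumes "finite S" "S \<subseteq> carrier V" "L \<subseteq> span S" "lin_indpt L"
  shows "finite L"
proof (rule ccontr)
  assume "infinite L"
  then obtain A where A: "A \<subseteq> L" "finite A" "card A = Suc (card S)"
    using infinite_arbitrarily_large by metis
  have "lin_indpt A" using subset_li_is_li assms(4) A(1) by blast
  moreover have "A \<subseteq> span S" using A(1) assms(3) by blast
  ultimately show False using replacement[OF A(2) assms(1,2)] A(3) by auto
qed

text \<open>
  For finite \<open>B\<close> this is Steinitz exchange. For infinite \<open>B\<close> it is a counting argument: every vector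
  lies in the span of a finite subset of \<open>B\<close>, each such span contains only finitely many elements
  of \<open>L\<close>, and \<open>B\<close> has only \<open>|B|\<close> finite subsets.
\<close>

lemma (in vectorspace) card_lin_indpt_le_card_gen_set:
  assumes L: "lin_indpt L" "L \<subseteq> carrier V" and B: "gen_set B" "B \<subseteq> carrier V"
  shows "|L| \<le>o |B|"
proof (cases "finite B")
  case True
  have "finite L" using lin_indpt_in_finite_span True assms by metis
  then show ?thesis using li_smaller_than_gen True assms by (simp add: card_of_ordLeq_finite finite_card_of_iff_card2)
next
  case False
  have "\<exists>S\<in>Fpow B. l \<in> span S" if "l \<in> L" for l
  proof -
    have "l \<in> span B" using that L(2) unfolding B(1) by (rule subsetD[rotated])
    then obtain a A where A: "finite A" "A \<subseteq> B" "a \<in> A \<rightarrow> carrier K" "l = lincomb a A"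
      unfolding span_def mem_Collect_eq by (elim exE conjE)
    have "l \<in> span A"
      unfolding span_def mem_Collect_eq using A by (intro exI[of _ a] exI[of _ A]) simp
    then show ?thesis using A(1,2) by (intro bexI[of _ A]) (simp_all add: Fpow_def)
  qed
  then have "L \<subseteq> (\<Union>S\<in>Fpow B. L \<inter> span S)" by blast
  moreover have "|\<Union>S\<in>Fpow B. L \<inter> span S| \<le>o |B|"
  proof (rule card_of_UNION_ordLeq_infinite[OF False])
    show "|Fpow B| \<le>o |B|"
      using eqpoll_Fpow[OF False] ordIso_imp_ordLeq by (simp add: eqpoll_iff_card_of_ordIso)
    have "finite (L \<inter> span S)" if "S \<in> Fpow B" for S
    proof (rule lin_indpt_in_finite_span[of S])
      show "finite S" "S \<subseteq> carrier V" using that B(2) by (auto simp: Fpow_def)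
      show "lin_indpt (L \<inter> span S)" using subset_li_is_li[OF L(1)] by blast
    qed simp
    then show "\<forall>S\<in>Fpow B. |L \<inter> span S| \<le>o |B|"
      using False by (simp add: ordLess_imp_ordLeq finite_ordLess_infinite Field_card_of card_of_Well_order)
  qed
  ultimately show ?thesis using card_of_mono1 ordLeq_transitive by blast
qed

text \<open>
  Each of two bases is linearly independent and the other one generates, so the basis chosen in the
  definition of \<^const>\<open>vdim\<close> may be replaced by any other.
\<close>

lemma (in vectorspace) vdim_basis:
  assumes "basis B"
  shows "vdim K V =o |B|"
proof -
  define C where "C = (SOME C. basis C)"
  have "basis C" unfolding C_def by (rule someI_ex[OF exists_basis])
  then have "|C| =o |B|"
    using assms by (simp add: ordIso_iff_ordLeq card_lin_indpt_le_card_gen_set basis_def)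
  then show ?thesis by (simp add: vdim_def C_def)
qed

lemma Card_order_vdim: "Card_order (vdim F V)"
  by (simp add: vdim_def)

lemma (in vectorspace) vdim_eq_one_iff:
  "vdim K V =o cone \<longleftrightarrow>
     (\<exists>v\<in>carrier V. v \<noteq> \<zero>\<^bsub>V\<^esub> \<and> (\<forall>x\<in>carrier V. \<exists>c\<in>carrier K. x = c \<odot>\<^bsub>V\<^esub> v))"
    (is "?one \<longleftrightarrow> (\<exists>v\<in>carrier V. ?gen v)")
proof -
  have lc: "lincomb a {v} = a v \<odot>\<^bsub>V\<^esub> v" if "v \<in> carrier V" "a v \<in> carrier K" for a v
    using that by (simp add: lincomb_def)
  have sp: "span {v} = {c \<odot>\<^bsub>V\<^esub> v | c. c \<in> carrier K}" if "v \<in> carrier V" for v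
  proof -
    have "span {v} = {lincomb a {v} | a. a \<in> {v} \<rightarrow> carrier K}"
      using that by (simp add: finite_span)
    also have "\<dots> = {c \<odot>\<^bsub>V\<^esub> v | c. c \<in> carrier K}"
    proof safe
      fix c assume "c \<in> carrier K"
      then show "\<exists>a. c \<odot>\<^bsub>V\<^esub> v = lincomb a {v} \<and> a \<in> {v} \<rightarrow> carrier K"
        using that by (intro exI[of _ "\<lambda>_. c"]) (simp add: lc)
    qed (use that in \<open>auto simp: lc\<close>)
    finally show ?thesis .
  qed
  show ?thesis
  proof
    assume one: ?one
    obtain B where B: "basis B" using exists_basis by blast
    have "|B| =o cone" using ordIso_transitive[OF ordIso_symmetric[OF vdim_basis[OF B]] one] .
    then have "B \<approx> {()}" by (simp add: eqpoll_iff_card_of_ordIso cone_def)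
    then obtain v where "B = {v}" by (auto simp: eqpoll_singleton_iff)
    then have v: "v \<in> carrier V" "lin_indpt {v}" "span {v} = carrier V"
      using B by (simp_all add: basis_def)
    have "v \<noteq> \<zero>\<^bsub>V\<^esub>" using vs_zero_lin_dep[of "{v}"] v(1,2) by simp
    moreover have "\<exists>c\<in>carrier K. x = c \<odot>\<^bsub>V\<^esub> v" if "x \<in> carrier V" for x
      using that sp[OF v(1)] unfolding v(3) by blast
    ultimately show "\<exists>v\<in>carrier V. ?gen v" using v(1) by (intro bexI[of _ v]) simp_all
  next
    assume "\<exists>v\<in>carrier V. ?gen v"
    then obtain v where v: "v \<in> carrier V" "v \<noteq> \<zero>\<^bsub>V\<^esub>" "?gen v" by blast
    have "lin_indpt {v}"
    proof (rule finite_lin_indpt2)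
      fix a assume a: "a \<in> {v} \<rightarrow> carrier K" "lincomb a {v} = \<zero>\<^bsub>V\<^esub>"
      then have "a v \<in> carrier K" "a v \<odot>\<^bsub>V\<^esub> v = \<zero>\<^bsub>V\<^esub>" using v(1) by (auto simp: lc)
      then have "a v = \<zero>\<^bsub>K\<^esub>"
        using v(1,2) mult_inverse[of "a v" v "\<zero>\<^bsub>V\<^esub>"] by (metis smult_r_null inverse_exists)
      then show "\<forall>w\<in>{v}. a w = \<zero>\<^bsub>K\<^esub>" by simp
    qed (use v(1) in simp_all)
    moreover have "span {v} = carrier V"
    proof
      show "carrier V \<subseteq> span {v}"
      proof
        fix x assume "x \<in> carrier V"
        then obtain c where "c \<in> carrier K" "x = c \<odot>\<^bsub>V\<^esub> v" using v(3) by metis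
        then show "x \<in> span {v}" unfolding sp[OF v(1)] by blast
      qed
      show "span {v} \<subseteq> carrier V" using v(1) by (intro span_is_subset2) simp
    qed
    ultimately have "basis {v}" using v(1) by (simp add: basis_def)
    then have "vdim K V =o |{v}|" by (rule vdim_basis)
    moreover have "|{v}| =o cone"
      using singleton_eqpoll[of v "()"] by (simp add: eqpoll_iff_card_of_ordIso cone_def)
    ultimately show ?one by (rule ordIso_transitive)
  qed
qed

lemma (in linear_map) lincomb_image_inj_on:
  assumes "inj_on T A" "finite A" "A \<subseteq> carrier V" "a \<in> A \<rightarrow> carrier K" "b \<in> T ` A \<rightarrow> carrier K"
    and "\<And>v. v \<in> A \<Longrightarrow> a v = b (T v)"
  shows "W.module.lincomb b (T ` A) = T (V.module.lincomb a A)"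
proof -
  have "T (V.module.lincomb a A) = (\<Oplus>\<^bsub>W\<^esub>v\<in>A. T (a v \<odot>\<^bsub>V\<^esub> v))"
    unfolding V.module.lincomb_def using assms(2-4) by (intro hom_sum) auto
  also have "\<dots> = (\<Oplus>\<^bsub>W\<^esub>v\<in>A. b (T v) \<odot>\<^bsub>W\<^esub> T v)"
    using assms(3-6) by (intro W.module.M.finsum_cong') (auto simp: Pi_iff subset_iff)
  also have "\<dots> = W.module.lincomb b (T ` A)"
    unfolding W.module.lincomb_def using assms
    by (subst W.module.M.finsum_reindex) (auto simp: Pi_iff subset_iff)
  finally show ?thesis ..
qed

section \<open>Comparison of dimensions along linear maps\<close>

lemma linear_mapI:
  assumes "vectorspace F V" "vectorspace F W" "T \<in> module_hom F V W"
  shows "linear_map F V W T"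
  using assms by (simp add: linear_map_def mod_hom_def mod_hom_axioms_def vectorspace_def)

lemma linear_map_comp:
  assumes "linear_map F A B h" "linear_map F B C k"
  shows "linear_map F A C (\<lambda>x. k (h x))"
proof -
  interpret h: linear_map F A B h by fact
  interpret k: linear_map F B C k by fact
  have "(\<lambda>x. k (h x)) \<in> module_hom F A C"
    unfolding module_hom_def mem_Collect_eq
    by (intro conjI allI impI funcsetI k.T_im h.T_im)
      (simp_all add: h.T_add h.T_smult k.T_add k.T_smult h.T_im)
  then show ?thesis
    using h.V.vectorspace_axioms k.W.vectorspace_axioms by (intro linear_mapI)
qed

lemma (in abelian_group) eq_of_minus_eq_zero:
  assumes "x \<in> carrier G" "y \<in> carrier G" "x \<ominus> y = \<zero>"
  shows "x = y"
  using assms by (metis a_minus_def add.inv_closed minus_equality minus_minus a_comm)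

text \<open>
  The common core of the two comparisons of dimensions below. \<open>L\<close> consists of preimages under \<open>P\<close> of a
  basis of \<open>Q\<close>. A linear relation between the vectors \<open>T l\<close> is the image under \<open>T\<close> of a combination of
  \<open>L\<close> in the kernel of \<open>T\<close>, hence in that of \<open>P\<close>, and so all coefficients vanish. The last clause is
  the same argument for a combination that is killed by \<open>P\<close> only.
\<close>

lemma exists_lifted_basis:
  assumes P: "linear_map F M Q P" and T: "linear_map F M V T"
    and surj: "P ` carrier M = carrier Q"
    and ker: "\<And>x. x \<in> carrier M \<Longrightarrow> T x = \<zero>\<^bsub>V\<^esub> \<Longrightarrow> P x = \<zero>\<^bsub>Q\<^esub>"
  obtains L where "L \<subseteq> carrier M" "inj_on P L" "inj_on T L" "vectorspace.basis F Q (P ` L)"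
    "\<not> module.lin_dep F V (T ` L)"
    "\<And>x. x \<in> module.span F V (T ` L) \<Longrightarrow>
       \<exists>u\<in>carrier M. T u = x \<and> (P u = \<zero>\<^bsub>Q\<^esub> \<longrightarrow> x = \<zero>\<^bsub>V\<^esub>)"
proof -
  interpret P: linear_map F M Q P by (rule P)
  interpret T: linear_map F M V T by (rule T)
  obtain B where B: "P.W.basis B" using P.W.exists_basis by blast
  then have "B \<subseteq> P ` carrier M" using surj by (simp add: P.W.basis_def)
  then obtain L where L: "L \<subseteq> carrier M" "inj_on P L" "P ` L = B"
    by (metis subset_image_inj)
  have injT: "inj_on T L"
  proof (rule inj_onI)
    fix x y assume xy: "x \<in> L" "y \<in> L" "T x = T y"
    then have c: "x \<in> carrier M" "y \<in> carrier M" using L(1) by auto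
    have cm: "x \<ominus>\<^bsub>M\<^esub> y \<in> carrier M"
      using c by (rule abelian_group.minus_closed[OF P.V.module.M.abelian_group_axioms])
    have "T (x \<ominus>\<^bsub>M\<^esub> y) = T x \<ominus>\<^bsub>V\<^esub> T y" using c by (rule T.T_minus)
    also have "\<dots> = \<zero>\<^bsub>V\<^esub>"
      unfolding xy(3) a_minus_def using T.T_im[OF c(2)] by (rule T.W.module.M.r_neg)
    finally have "P (x \<ominus>\<^bsub>M\<^esub> y) = \<zero>\<^bsub>Q\<^esub>" by (rule ker[OF cm])
    then have "P x \<ominus>\<^bsub>Q\<^esub> P y = \<zero>\<^bsub>Q\<^esub>" unfolding P.T_minus[OF c] .
    then have "P x = P y"
      by (rule abelian_group.eq_of_minus_eq_zero[OF P.W.module.M.abelian_group_axioms P.T_im[OF c(1)] P.T_im[OF c(2)]])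
    then show "x = y" using inj_onD[OF L(2) _ xy(1,2)] by blast
  qed
  \<comment> \<open>The witness \<open>u\<close> is the combination of the preimages of \<open>A\<close> in \<open>L\<close> with the coefficients \<open>a\<close>.\<close>
  have combination: "\<exists>u\<in>carrier M. T u = T.W.module.lincomb a A \<and> (P u = \<zero>\<^bsub>Q\<^esub> \<longrightarrow> a \<in> A \<rightarrow> {\<zero>\<^bsub>F\<^esub>})"
    if A: "finite A" "A \<subseteq> T ` L" "a \<in> A \<rightarrow> carrier F" for a A
  proof -
    obtain A' where A': "A' \<subseteq> L" "inj_on T A'" "T ` A' = A"
      using A(2) by (metis subset_image_inj)
    have fin: "finite A'" using A' A(1) finite_imageD by blast
    have c: "A' \<subseteq> carrier M" using A'(1) L(1) by blast
    have injP: "inj_on P A'" using L(2) A'(1) inj_on_subset by blast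
    define b where "b = a \<circ> T"
    define d where "d = b \<circ> inv_into A' P"
    have d: "d (P v) = b v" if "v \<in> A'" for v
      using that injP by (simp add: d_def)
    have bc: "b \<in> A' \<rightarrow> carrier F"
      unfolding b_def A'(3)[symmetric] comp_def
      using A(3) A'(3) by (intro funcsetI) (metis imageI funcset_mem)
    let ?u = "P.V.module.lincomb b A'"
    have u: "?u \<in> carrier M" using c bc by (rule P.V.module.lincomb_closed)
    moreover have "T ?u = T.W.module.lincomb a A"
      using T.lincomb_image_inj_on[OF A'(2) fin c bc, of a] A(3) by (simp add: A'(3) b_def)
    moreover have "a \<in> A \<rightarrow> {\<zero>\<^bsub>F\<^esub>}" if "P ?u = \<zero>\<^bsub>Q\<^esub>"
    proof -
      have dc: "d \<in> P ` A' \<rightarrow> carrier F"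
      proof
        fix y assume "y \<in> P ` A'"
        then obtain v where v: "v \<in> A'" "y = P v" by (elim imageE)
        show "d y \<in> carrier F" unfolding v(2) d[OF v(1)] using bc v(1) by (rule funcset_mem)
      qed
      have "P.W.module.lincomb d (P ` A') = P ?u"
        using injP fin c bc dc d[symmetric] by (rule P.lincomb_image_inj_on)
      also have "\<dots> = \<zero>\<^bsub>Q\<^esub>" by (rule that)
      finally have dz: "P.W.module.lincomb d (P ` A') = \<zero>\<^bsub>Q\<^esub>" .
      have "P ` A' \<subseteq> B" using A'(1) L(3) by blast
      moreover have "\<not> P.W.module.lin_dep B" using B by (simp add: P.W.basis_def)
      ultimately have "d \<in> P ` A' \<rightarrow> {\<zero>\<^bsub>F\<^esub>}"
        using P.W.not_lindepD[OF _ finite_imageI[OF fin] _ dc dz] by blast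
      then have "d (P v) = \<zero>\<^bsub>F\<^esub>" if "v \<in> A'" for v using that by blast
      then have "b v = \<zero>\<^bsub>F\<^esub>" if "v \<in> A'" for v using d that by metis
      then have "a y \<in> {\<zero>\<^bsub>F\<^esub>}" if "y \<in> T ` A'" for y
        using that unfolding b_def comp_def by (elim imageE) simp
      then show ?thesis unfolding A'(3) by (rule funcsetI)
    qed
    ultimately show ?thesis by (intro bexI[of _ ?u] conjI impI)
  qed
  show thesis
  proof (rule that[OF L(1,2) injT])
    show "P.W.basis (P ` L)" using B L(3) by simp
    show "\<not> T.W.module.lin_dep (T ` L)"
    proof
      assume dep: "T.W.module.lin_dep (T ` L)"
      obtain A a v where A: "finite A" "A \<subseteq> T ` L" "a \<in> A \<rightarrow> carrier F"
          "T.W.module.lincomb a A = \<zero>\<^bsub>V\<^esub>" "v \<in> A" "a v \<noteq> \<zero>\<^bsub>F\<^esub>"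
        using dep unfolding T.W.module.lin_dep_def by (elim exE conjE)
      obtain u where u: "u \<in> carrier M" "T u = \<zero>\<^bsub>V\<^esub>" "P u = \<zero>\<^bsub>Q\<^esub> \<longrightarrow> a \<in> A \<rightarrow> {\<zero>\<^bsub>F\<^esub>}"
        using combination[OF A(1-3)] unfolding A(4) by (elim bexE conjE)
      have "a \<in> A \<rightarrow> {\<zero>\<^bsub>F\<^esub>}" using u(3) ker[OF u(1,2)] by (rule mp)
      then have "a v \<in> {\<zero>\<^bsub>F\<^esub>}" using A(5) by (rule funcset_mem)
      then show False using A(6) by simp
    qed
    show "\<exists>u\<in>carrier M. T u = x \<and> (P u = \<zero>\<^bsub>Q\<^esub> \<longrightarrow> x = \<zero>\<^bsub>V\<^esub>)"
      if x: "x \<in> T.W.module.span (T ` L)" for x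
    proof -
      obtain a A where A: "finite A" "A \<subseteq> T ` L" "a \<in> A \<rightarrow> carrier F" "x = T.W.module.lincomb a A"
        using x unfolding T.W.module.span_def mem_Collect_eq by (elim exE conjE)
      obtain u where u: "u \<in> carrier M" "T u = x" "P u = \<zero>\<^bsub>Q\<^esub> \<longrightarrow> a \<in> A \<rightarrow> {\<zero>\<^bsub>F\<^esub>}"
        using combination[OF A(1-3)] unfolding A(4)[symmetric] by (elim bexE conjE)
      have "T ` L \<subseteq> carrier V" using T.T_im L(1) by (meson image_subsetI subsetD)
      with A(2) have AV: "A \<subseteq> carrier V" by (rule subset_trans)
      have "x = \<zero>\<^bsub>V\<^esub>" if "P u = \<zero>\<^bsub>Q\<^esub>"
        unfolding A(4) using AV mp[OF u(3) that] by (rule T.W.lincomb_zero)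
      with u(2) show ?thesis by (intro bexI[OF _ u(1)] conjI impI)
    qed
  qed
qed

text \<open>
  If \<open>T\<close> kills no more than the surjection \<open>P\<close> does, then \<open>Q\<close> is a quotient of the image of \<open>T\<close>. The two
  cases that matter are \<open>P\<close> with the same kernel as \<open>T\<close>, where \<open>Q\<close> embeds into \<open>V\<close>, and \<open>T\<close> the identity,
  where \<open>Q\<close> is a quotient of \<open>V\<close>.
\<close>

lemma vdim_le_of_ker_le:
  assumes "linear_map F M Q P" "linear_map F M V T" "P ` carrier M = carrier Q"
    and "\<And>x. x \<in> carrier M \<Longrightarrow> T x = \<zero>\<^bsub>V\<^esub> \<Longrightarrow> P x = \<zero>\<^bsub>Q\<^esub>"
  shows "vdim F Q \<le>o vdim F V"
proof -
  obtain L where L: "L \<subseteq> carrier M" "inj_on P L" "inj_on T L" "vectorspace.basis F Q (P ` L)"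
    "\<not> module.lin_dep F V (T ` L)"
    using exists_lifted_basis[OF assms] by metis
  interpret T: linear_map F M V T by fact
  obtain B where B: "T.W.basis B" using T.W.exists_basis by blast
  have "vdim F Q =o |P ` L|"
    using assms(1) L(4) vectorspace.vdim_basis unfolding linear_map_def by blast
  also have "|P ` L| =o |T ` L|"
    using L(2,3) by (meson card_of_ordIsoI inj_on_imp_bij_betw ordIso_symmetric ordIso_transitive)
  also have "|T ` L| \<le>o |B|"
  proof (rule T.W.card_lin_indpt_le_card_gen_set[OF L(5)])
    show "T ` L \<subseteq> carrier V" using L(1) by auto
  qed (use B in \<open>simp_all add: T.W.basis_def\<close>)
  also have "|B| =o vdim F V" using T.W.vdim_basis[OF B] by (rule ordIso_symmetric)
  finally show ?thesis .
qed

text \<open>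
  The vector \<open>y\<close> makes the inequality strict in both cases: it is either outside the image of \<open>T\<close>
  (and then its last property is vacuous), or it is the image of a vector killed by \<open>P\<close> but not by
  \<open>T\<close>. Either way \<open>y\<close> can be added to the independent set \<open>T ` L\<close>, and for a finite dimension one
  more vector is a strict increase.
\<close>

lemma vdim_less_of_ker_le:
  assumes "linear_map F M Q P" "linear_map F M V T" "P ` carrier M = carrier Q"
    and "\<And>x. x \<in> carrier M \<Longrightarrow> T x = \<zero>\<^bsub>V\<^esub> \<Longrightarrow> P x = \<zero>\<^bsub>Q\<^esub>"
    and fin: "vdim F V <o natLeq"
    and y: "y \<in> carrier V" "y \<noteq> \<zero>\<^bsub>V\<^esub>" "\<And>x. x \<in> carrier M \<Longrightarrow> T x = y \<Longrightarrow> P x = \<zero>\<^bsub>Q\<^esub>"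
  shows "vdim F Q <o vdim F V"
proof -
  obtain L where L: "L \<subseteq> carrier M" "inj_on P L" "inj_on T L" "vectorspace.basis F Q (P ` L)"
    "\<not> module.lin_dep F V (T ` L)"
    and span: "\<And>x. x \<in> module.span F V (T ` L) \<Longrightarrow>
       \<exists>u\<in>carrier M. T u = x \<and> (P u = \<zero>\<^bsub>Q\<^esub> \<longrightarrow> x = \<zero>\<^bsub>V\<^esub>)"
    using exists_lifted_basis[OF assms(1-4)] by metis
  interpret T: linear_map F M V T by fact
  have TL: "T ` L \<subseteq> carrier V" using L(1) by auto
  have y_span: "y \<notin> T.W.module.span (T ` L)" using span y(2,3) by blast
  have y_TL: "y \<notin> T ` L" using y_span T.W.module.in_own_span[OF TL] by blast
  then have "\<not> T.W.module.lin_dep (T ` L \<union> {y})"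
    using T.W.lin_dep_iff_in_span[OF TL L(5) y(1)] y_span by blast
  moreover obtain B where B: "T.W.basis B" using T.W.exists_basis by blast
  ultimately have le: "|T ` L \<union> {y}| \<le>o |B|"
    using TL y(1) T.W.card_lin_indpt_le_card_gen_set by (simp add: T.W.basis_def)
  have "|B| <o natLeq"
    using fin T.W.vdim_basis[OF B] ordIso_symmetric ordIso_ordLess_trans by blast
  then have "finite B" by (simp add: finite_iff_ordLess_natLeq)
  then have finL: "finite (T ` L)" using le card_of_ordLeq_finite by blast
  have "vdim F Q =o |P ` L|"
    using assms(1) L(4) vectorspace.vdim_basis unfolding linear_map_def by blast
  also have "|P ` L| =o |T ` L|"
    using L(2,3) by (meson card_of_ordIsoI inj_on_imp_bij_betw ordIso_symmetric ordIso_transitive)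
  also have "|T ` L| <o |T ` L \<union> {y}|"
    using finL y_TL by (simp add: finite_card_of_iff_card3)
  also have "|T ` L \<union> {y}| \<le>o |B|" by (rule le)
  also have "|B| =o vdim F V" using T.W.vdim_basis[OF B] by (rule ordIso_symmetric)
  finally show ?thesis .
qed

section \<open>Invariant functions of a primitive action\<close>

text \<open>
  The fibres of \<open>f\<close> form a partition of \<open>\<Omega>\<close> that the group preserves.
\<close>

lemma primitive_invariant_function:
  assumes "group_action G \<Omega> act" "primitive_action G \<Omega> act"
    and inv: "\<And>g x y. \<lbrakk>g \<in> carrier G; x \<in> \<Omega>; y \<in> \<Omega>; f x = f y\<rbrakk> \<Longrightarrow> f (act g x) = f (act g y)"
  shows "inj_on f \<Omega> \<or> (\<forall>x\<in>\<Omega>. \<forall>y\<in>\<Omega>. f x = f y)"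
proof -
  interpret A: group_action G \<Omega> act by fact
  interpret G: group G using A.group_hom by (simp add: group_hom_def)
  define fib where "fib = (\<lambda>x. {y \<in> \<Omega>. f y = f x})"
  have "partition_on \<Omega> (fib ` \<Omega>)"
  proof (rule partition_onI)
    show "disjnt A B" if "A \<in> fib ` \<Omega>" "B \<in> fib ` \<Omega>" "A \<noteq> B" for A B
      using that by (auto simp: fib_def disjnt_def)
  qed (auto simp: fib_def)
  moreover have "act g ` A \<in> fib ` \<Omega>" if g: "g \<in> carrier G" and "A \<in> fib ` \<Omega>" for g A
  proof -
    obtain x where x: "x \<in> \<Omega>" "A = fib x" using \<open>A \<in> fib ` \<Omega>\<close> by blast
    have gx: "act h y \<in> \<Omega>" if "h \<in> carrier G" "y \<in> \<Omega>" for h y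
      using that A.element_image by blast
    have "act g ` fib x = fib (act g x)"
    proof
      show "act g ` fib x \<subseteq> fib (act g x)"
      proof (rule image_subsetI)
        fix y assume "y \<in> fib x"
        then have y: "y \<in> \<Omega>" "f y = f x" by (simp_all add: fib_def)
        then show "act g y \<in> fib (act g x)"
          unfolding fib_def using gx[OF g y(1)] inv[OF g y(1) x(1) y(2)] by blast
      qed
      \<comment> \<open>Invariance of \<open>f\<close> under the inverse of \<open>g\<close>.\<close>
      show "fib (act g x) \<subseteq> act g ` fib x"
      proof
        fix y assume "y \<in> fib (act g x)"
        then have y: "y \<in> \<Omega>" "f y = f (act g x)" by (simp_all add: fib_def)
        let ?z = "act (inv\<^bsub>G\<^esub> g) y"
        have "act (inv\<^bsub>G\<^esub> g) (act g x) = x" using A.orbit_sym_aux[OF g x(1)] by simp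
        then have "f ?z = f x"
          using inv[OF G.inv_closed[OF g] y(1) gx[OF g x(1)] y(2)] by simp
        moreover have "act g ?z = y"
          using A.orbit_sym_aux[of "inv\<^bsub>G\<^esub> g" y] g y by simp
        moreover have "?z \<in> \<Omega>" using gx g y(1) by simp
        ultimately show "y \<in> act g ` fib x"
          by (intro image_eqI[of _ _ ?z]) (simp_all add: fib_def)
      qed
    qed
    then show ?thesis using x(2) gx[OF g x(1)] by simp
  qed
  ultimately have "partition_on \<Omega> (fib ` \<Omega>) \<and> (\<forall>g\<in>carrier G. \<forall>A\<in>fib ` \<Omega>. act g ` A \<in> fib ` \<Omega>)"
    by (intro conjI ballI)
  then have "fib ` \<Omega> = {\<Omega>} \<or> fib ` \<Omega> = {{\<omega>} | \<omega>. \<omega> \<in> \<Omega>}"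
    by (rule assms(2)[unfolded primitive_action_def, THEN spec, THEN mp])
  then show ?thesis
  proof
    assume "fib ` \<Omega> = {\<Omega>}"
    then have "fib x = \<Omega>" if "x \<in> \<Omega>" for x using that by blast
    then show ?thesis unfolding fib_def by blast
  next
    assume s: "fib ` \<Omega> = {{\<omega>} | \<omega>. \<omega> \<in> \<Omega>}"
    have "inj_on f \<Omega>"
    proof (rule inj_onI)
      fix x y assume xy: "x \<in> \<Omega>" "y \<in> \<Omega>" "f x = f y"
      then obtain z where "fib x = {z}" using s by blast
      moreover have "x \<in> fib x" "y \<in> fib x" using xy by (auto simp: fib_def)
      ultimately show "x = y" by simp
    qed
    then show ?thesis ..
  qed
qed

lemma cyclic_induced_groupI:
  assumes "group_action G \<Omega> act" and g: "g \<in> carrier G"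
    and pow: "\<And>h. h \<in> carrier G \<Longrightarrow> \<exists>n::int. \<forall>x\<in>\<Omega>. act h x = act (g [^]\<^bsub>G\<^esub> n) x"
  shows "cyclic_group (induced_group G \<Omega> act)"
proof -
  interpret A: group_action G \<Omega> act by fact
  interpret H: group_hom G "BijGroup \<Omega>" act by (rule A.group_hom)
  let ?I = "induced_group G \<Omega> act"
  have I: "group ?I"
    using subgroup.subgroup_is_group[OF H.img_is_subgroup H.H.is_group] by (simp add: induced_group_def)
  have "act \<in> hom G ?I"
    by (intro homI) (auto simp: induced_group_def)
  then have hom: "act (g [^]\<^bsub>G\<^esub> n) = act g [^]\<^bsub>?I\<^esub> n" for n :: int
    using g H.G.is_group I by (rule hom_int_pow)
  have gI: "act g \<in> carrier ?I" using g by (simp add: induced_group_def)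
  have eq: "carrier ?I = range (\<lambda>n::int. act g [^]\<^bsub>?I\<^esub> n)"
  proof
    show "carrier ?I \<subseteq> range (\<lambda>n::int. act g [^]\<^bsub>?I\<^esub> n)"
    proof
      fix \<sigma> assume "\<sigma> \<in> carrier ?I"
      then obtain h where h: "h \<in> carrier G" "\<sigma> = act h" by (auto simp: induced_group_def)
      then obtain n :: int where n: "\<forall>x\<in>\<Omega>. act h x = act (g [^]\<^bsub>G\<^esub> n) x" using pow by blast
      have "act k \<in> extensional \<Omega>" if "k \<in> carrier G" for k
        using A.bij_prop0[OF that] by (simp add: Bij_def)
      then have h_eq: "act h = act (g [^]\<^bsub>G\<^esub> n)"
        using n h(1) g by (intro extensionalityI[of _ \<Omega>]) auto
      show "\<sigma> \<in> range (\<lambda>n::int. act g [^]\<^bsub>?I\<^esub> n)" unfolding h(2) h_eq hom by (rule rangeI)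
    qed
    show "range (\<lambda>n::int. act g [^]\<^bsub>?I\<^esub> n) \<subseteq> carrier ?I"
      using group.int_pow_closed[OF I gI] by blast
  qed
  show ?thesis unfolding group.cyclic_group[OF I] using eq gI by (rule bexI)
qed

lemma not_cyclic_imp_moved_point:
  assumes "group_action G \<Omega> act" "\<not> cyclic_group (induced_group G \<Omega> act)"
  obtains g x where "g \<in> carrier G" "x \<in> \<Omega>" "act g x \<in> \<Omega>" "act g x \<noteq> x"
proof -
  interpret A: group_action G \<Omega> act by fact
  interpret G: group G using A.group_hom by (simp add: group_hom_def)
  have "\<exists>g\<in>carrier G. \<exists>x\<in>\<Omega>. act g x \<noteq> x"
  proof (rule ccontr)
    assume "\<not> ?thesis"
    then have "act h x = act (\<one>\<^bsub>G\<^esub> [^]\<^bsub>G\<^esub> (0::int)) x" if "h \<in> carrier G" "x \<in> \<Omega>" for h x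
      using that by simp
    then have "cyclic_group (induced_group G \<Omega> act)"
      using cyclic_induced_groupI[OF assms(1) G.one_closed] by blast
    then show False using assms(2) by simp
  qed
  then show thesis using that A.element_image by blast
qed

text \<open>
  Suppose all elements of the group commute in their action, and let \<open>g\<close> move a point. The partition
  into orbits of \<open>\<langle>g\<rangle>\<close> is then invariant under the whole group, so primitivity makes \<open>\<langle>g\<rangle>\<close> transitive.
  An element \<open>h\<close> agrees with some power of \<open>g\<close> at one point, and by commutativity it agrees with this
  power along the orbit of \<open>\<langle>g\<rangle>\<close>, that is, everywhere. Hence \<open>g\<close> generates the induced group.
\<close>

lemma primitive_not_cyclic_imp_not_commuting:
  assumes "group_action G \<Omega> act" "primitive_action G \<Omega> act"
    and "\<not> cyclic_group (induced_group G \<Omega> act)"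
  shows "\<exists>g\<in>carrier G. \<exists>h\<in>carrier G. \<exists>x\<in>\<Omega>. act g (act h x) \<noteq> act h (act g x)"
proof (rule ccontr)
  assume "\<not> ?thesis"
  then have comm: "act g (act h x) = act h (act g x)"
    if "g \<in> carrier G" "h \<in> carrier G" "x \<in> \<Omega>" for g h x
    using that by blast
  interpret A: group_action G \<Omega> act by fact
  interpret G: group G using A.group_hom by (simp add: group_hom_def)
  have c: "act h z \<in> \<Omega>" if "h \<in> carrier G" "z \<in> \<Omega>" for h z
    using that A.element_image by blast
  obtain g z where g: "g \<in> carrier G" "z \<in> \<Omega>" "act g z \<in> \<Omega>" "act g z \<noteq> z"
    using not_cyclic_imp_moved_point[OF assms(1,3)] by blast
  define orb where "orb = (\<lambda>x. range (\<lambda>n::int. act (g [^]\<^bsub>G\<^esub> n) x))"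
  have "orb (act h x) = act h ` orb x" if "h \<in> carrier G" "x \<in> \<Omega>" for h x
    unfolding orb_def image_image
  proof (rule image_cong)
    show "act (g [^]\<^bsub>G\<^esub> n) (act h x) = act h (act (g [^]\<^bsub>G\<^esub> n) x)" for n :: int
      by (rule comm) (use that g(1) in simp_all)
  qed simp
  then have "inj_on orb \<Omega> \<or> (\<forall>x\<in>\<Omega>. \<forall>y\<in>\<Omega>. orb x = orb y)"
    by (intro primitive_invariant_function[OF assms(1,2)]) simp
  moreover have "\<not> inj_on orb \<Omega>"
  proof
    have "orb (act g z) = range (\<lambda>n::int. act (g [^]\<^bsub>G\<^esub> (n + 1)) z)"
      unfolding orb_def
    proof (rule image_cong)
      fix n :: int
      have "act (g [^]\<^bsub>G\<^esub> n) (act g z) = act (g [^]\<^bsub>G\<^esub> n \<otimes>\<^bsub>G\<^esub> g) z"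
        by (rule A.composition_rule[symmetric]) (use g in simp_all)
      then show "act (g [^]\<^bsub>G\<^esub> n) (act g z) = act (g [^]\<^bsub>G\<^esub> (n + 1)) z"
        using G.int_pow_mult[OF g(1), of n 1] G.int_pow_1[OF g(1)] by simp
    qed simp
    also have "\<dots> = (\<lambda>n. act (g [^]\<^bsub>G\<^esub> n) z) ` range (\<lambda>n::int. n + 1)"
      by (simp only: image_image)
    also have "range (\<lambda>n::int. n + 1) = UNIV" by (rule surjI[of _ "\<lambda>n. n - 1"]) simp
    finally have "orb (act g z) = orb z" by (simp add: orb_def)
    then show "inj_on orb \<Omega> \<Longrightarrow> False" using inj_onD[of orb \<Omega> "act g z" z] g by blast
  qed
  ultimately have orb: "orb x = orb y" if "x \<in> \<Omega>" "y \<in> \<Omega>" for x y using that by blast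
  have self: "x \<in> orb x" if "x \<in> \<Omega>" for x
  proof -
    have "act \<one>\<^bsub>G\<^esub> x = x" using that A.id_eq_one by (metis restrict_apply')
    then have "x = act (g [^]\<^bsub>G\<^esub> (0::int)) x" by simp
    then show ?thesis unfolding orb_def by (rule range_eqI)
  qed
  have "\<exists>n::int. \<forall>x\<in>\<Omega>. act h x = act (g [^]\<^bsub>G\<^esub> n) x" if h: "h \<in> carrier G" for h
  proof -
    have "act h z \<in> orb z" using self orb c g(2) h by blast
    then obtain n :: int where n: "act h z = act (g [^]\<^bsub>G\<^esub> n) z" by (auto simp: orb_def)
    have "act h x = act (g [^]\<^bsub>G\<^esub> n) x" if x: "x \<in> \<Omega>" for x
    proof -
      have "x \<in> orb z" using self orb x g(2) by blast
      then obtain m :: int where m: "x = act (g [^]\<^bsub>G\<^esub> m) z" by (auto simp: orb_def)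
      have gm: "g [^]\<^bsub>G\<^esub> m \<in> carrier G" "g [^]\<^bsub>G\<^esub> n \<in> carrier G" using g(1) by simp_all
      show ?thesis
        unfolding m comm[OF h gm(1) g(2)] comm[OF gm(2,1) g(2)] n ..
    qed
    then show ?thesis by blast
  qed
  then have "cyclic_group (induced_group G \<Omega> act)"
    using cyclic_induced_groupI[OF assms(1) g(1)] by blast
  then show False using assms(3) by simp
qed

section \<open>The quotient map\<close>

lemma quotient_map:
  assumes V: "vectorspace F V" and W: "submodule F W V"
  shows linear_map_quotient: "linear_map F V (quotient_space V W) (\<lambda>x. W +>\<^bsub>V\<^esub> x)"
    and quotient_map_surj: "(\<lambda>x. W +>\<^bsub>V\<^esub> x) ` carrier V = carrier (quotient_space V W)"
    and quotient_map_eq_zero_iff: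
      "x \<in> carrier V \<Longrightarrow> W +>\<^bsub>V\<^esub> x = \<zero>\<^bsub>quotient_space V W\<^esub> \<longleftrightarrow> x \<in> W"
proof -
  interpret V: vectorspace F V by fact
  interpret Q: vectorspace F "quotient_space V W" by (rule vectorspace_quotient_space) fact+
  interpret sub: submodule F W V by fact
  let ?Q = "quotient_space V W"
  have add: "additive_subgroup W V"
  proof -
    have "\<ominus>\<^bsub>V\<^esub> x \<in> W" if "x \<in> W" for x
      using that sub.subset sub.smult_closed
      by (metis V.R.a_inv_closed V.R.one_closed V.smult_minus_1_back subsetD)
    then show ?thesis
      using sub.subset by (intro additive_subgroupI subgroup.intro) (auto simp: a_inv_def)
  qed
  interpret W: abelian_subgroup W V
    using add by (intro abelian_subgroupI3) (auto intro: V.M.abelian_group_axioms)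
  have smult: "a \<odot>\<^bsub>?Q\<^esub> (W +>\<^bsub>V\<^esub> x) = W +>\<^bsub>V\<^esub> (a \<odot>\<^bsub>V\<^esub> x)"
    if a: "a \<in> carrier F" and x: "x \<in> carrier V" for a x
  proof -
    have "W +>\<^bsub>V\<^esub> (a \<odot>\<^bsub>V\<^esub> y) = W +>\<^bsub>V\<^esub> (a \<odot>\<^bsub>V\<^esub> x)" if y: "y \<in> W +>\<^bsub>V\<^esub> x" for y
    proof -
      obtain w where w: "w \<in> W" "y = w \<oplus>\<^bsub>V\<^esub> x" using y by (auto simp: a_r_coset_def')
      have "a \<odot>\<^bsub>V\<^esub> y = a \<odot>\<^bsub>V\<^esub> w \<oplus>\<^bsub>V\<^esub> a \<odot>\<^bsub>V\<^esub> x"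
        unfolding w(2) using subsetD[OF sub.subset w(1)] a x by (simp add: V.smult_r_distr)
      then have "a \<odot>\<^bsub>V\<^esub> y \<in> W +>\<^bsub>V\<^esub> (a \<odot>\<^bsub>V\<^esub> x)"
        using sub.smult_closed[OF a w(1)] by (auto simp: a_r_coset_def')
      then show ?thesis using W.a_repr_independence' V.smult_closed a x by metis
    qed
    moreover have "x \<in> W +>\<^bsub>V\<^esub> x" using x W.a_rcos_self by blast
    ultimately have "(\<Union>y\<in>W +>\<^bsub>V\<^esub> x. W +>\<^bsub>V\<^esub> (a \<odot>\<^bsub>V\<^esub> y)) = W +>\<^bsub>V\<^esub> (a \<odot>\<^bsub>V\<^esub> x)"
      by (intro UN_constant_eq) blast+
    then show ?thesis by (simp only: quotient_space_def module.simps)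
  qed
  show surj: "(\<lambda>x. W +>\<^bsub>V\<^esub> x) ` carrier V = carrier ?Q"
    by (auto simp: quotient_space_def A_RCOSETS_def')
  have "(\<lambda>x. W +>\<^bsub>V\<^esub> x) \<in> module_hom F V ?Q"
    unfolding module_hom_def mem_Collect_eq
  proof (intro conjI allI impI)
    show "(\<lambda>x. W +>\<^bsub>V\<^esub> x) \<in> carrier V \<rightarrow> carrier ?Q" using surj by blast
    show "W +>\<^bsub>V\<^esub> (x \<oplus>\<^bsub>V\<^esub> y) = (W +>\<^bsub>V\<^esub> x) \<oplus>\<^bsub>?Q\<^esub> (W +>\<^bsub>V\<^esub> y)"
      if "x \<in> carrier V \<and> y \<in> carrier V" for x y
      using that by (simp add: quotient_space_def W.a_rcos_sum)
    show "W +>\<^bsub>V\<^esub> (a \<odot>\<^bsub>V\<^esub> x) = a \<odot>\<^bsub>?Q\<^esub> (W +>\<^bsub>V\<^esub> x)" if "a \<in> carrier F \<and> x \<in> carrier V" for a x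
      using that smult by simp
  qed
  then show "linear_map F V ?Q (\<lambda>x. W +>\<^bsub>V\<^esub> x)"
    using V.vectorspace_axioms Q.vectorspace_axioms by (intro linear_mapI)
  show "W +>\<^bsub>V\<^esub> x = \<zero>\<^bsub>?Q\<^esub> \<longleftrightarrow> x \<in> W" if "x \<in> carrier V"
    using W.a_rcos_self[OF that] W.a_rcos_const[of x] by (auto simp: quotient_space_def)
qed

lemma submodule_minus_closed:
  assumes "vectorspace F V" "submodule F W V" "x \<in> W" "y \<in> W"
  shows "x \<ominus>\<^bsub>V\<^esub> y \<in> W"
proof -
  interpret V: vectorspace F V by fact
  interpret sub: submodule F W V by fact
  have "\<ominus>\<^bsub>V\<^esub> y \<in> W"
    using assms(4) sub.subset sub.smult_closed
    by (metis V.R.a_inv_closed V.R.one_closed V.smult_minus_1_back subsetD)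
  then show ?thesis unfolding a_minus_def using assms(3) by (rule sub.m_closed[rotated])
qed

section \<open>Representations of an action and their images\<close>

lemma action_rep_linear:
  assumes "action_rep F G \<Omega> act V \<rho> \<phi>" "g \<in> carrier G"
  shows "linear_map F V V (\<rho> g)"
proof -
  have "vectorspace F V" "\<rho> g \<in> module_hom F V V"
    using assms by (auto simp: action_rep_def GL_def hom_def)
  then show ?thesis
    by (simp add: linear_map_def mod_hom_def mod_hom_axioms_def vectorspace_def)
qed

lemma action_rep_mult:
  assumes "action_rep F G \<Omega> act V \<rho> \<phi>" "g \<in> carrier G" "h \<in> carrier G" "x \<in> carrier V"
  shows "\<rho> (g \<otimes>\<^bsub>G\<^esub> h) x = \<rho> g (\<rho> h x)"
proof -
  have "\<rho> \<in> hom G (GL F V)" using assms(1) by (simp add: action_rep_def)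
  then have "\<rho> g \<in> Bij (carrier V)" "\<rho> h \<in> Bij (carrier V)" "\<rho> (g \<otimes>\<^bsub>G\<^esub> h) = \<rho> g \<otimes>\<^bsub>GL F V\<^esub> \<rho> h"
    using assms(2,3) by (auto simp: hom_def GL_def)
  then have "\<rho> (g \<otimes>\<^bsub>G\<^esub> h) = compose (carrier V) (\<rho> g) (\<rho> h)"
    by (simp add: GL_def BijGroup_def)
  then show ?thesis using assms(4) by (simp add: compose_eq)
qed

text \<open>
  The image of the identity of \<open>G\<close> is an injective idempotent map.
\<close>

lemma action_rep_one:
  assumes "group G" "action_rep F G \<Omega> act V \<rho> \<phi>" "x \<in> carrier V"
  shows "\<rho> \<one>\<^bsub>G\<^esub> x = x"
proof -
  interpret G: group G by fact
  have "\<rho> \<one>\<^bsub>G\<^esub> \<in> Bij (carrier V)"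
    using assms(2) by (auto simp: action_rep_def hom_def GL_def)
  then have bij: "bij_betw (\<rho> \<one>\<^bsub>G\<^esub>) (carrier V) (carrier V)" by (simp add: Bij_def)
  have "\<rho> \<one>\<^bsub>G\<^esub> (\<rho> \<one>\<^bsub>G\<^esub> x) = \<rho> \<one>\<^bsub>G\<^esub> x"
    using action_rep_mult[OF assms(2) G.one_closed G.one_closed assms(3)] by simp
  then show ?thesis
    using inj_onD[OF bij_betw_imp_inj_on[OF bij], of "\<rho> \<one>\<^bsub>G\<^esub> x" x] bij_betwE[OF bij] assms(3) by blast
qed

text \<open>
  A surjection with invariant kernel transports the representation: \<open>g\<close> acts on \<open>P x\<close> by
  \<open>P x \<mapsto> P (\<rho> g x)\<close>, which depends only on \<open>P x\<close>.
\<close>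

lemma action_rep_linear_image:
  assumes "group G" and rep: "action_rep F G \<Omega> act V \<rho> \<phi>"
    and P: "linear_map F V Q P" and surj: "P ` carrier V = carrier Q"
    and ker: "\<And>g x. \<lbrakk>g \<in> carrier G; x \<in> carrier V; P x = \<zero>\<^bsub>Q\<^esub>\<rbrakk> \<Longrightarrow> P (\<rho> g x) = \<zero>\<^bsub>Q\<^esub>"
    and inj: "inj_on (P \<circ> \<phi>) \<Omega>"
  obtains \<sigma> where "action_rep F G \<Omega> act Q \<sigma> (P \<circ> \<phi>)"
proof -
  interpret G: group G by fact
  interpret P: linear_map F V Q P by fact
  have lin: "linear_map F V V (\<rho> g)" if "g \<in> carrier G" for g
    using rep that by (rule action_rep_linear)
  have \<rho>c: "\<rho> g x \<in> carrier V" if "g \<in> carrier G" "x \<in> carrier V" for g x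
    using that(2) by (rule mod_hom.f_im[OF linear_map.axioms(3)[OF lin[OF that(1)]]])
  have well: "P (\<rho> g x) = P (\<rho> g y)"
    if g: "g \<in> carrier G" and c: "x \<in> carrier V" "y \<in> carrier V" and eq: "P x = P y" for g x y
  proof (rule abelian_group.eq_of_minus_eq_zero[OF P.W.module.M.abelian_group_axioms])
    have cm: "x \<ominus>\<^bsub>V\<^esub> y \<in> carrier V"
      using c by (rule abelian_group.minus_closed[OF P.V.module.M.abelian_group_axioms])
    have "P (x \<ominus>\<^bsub>V\<^esub> y) = P x \<ominus>\<^bsub>Q\<^esub> P y" using c by (rule P.T_minus)
    also have "\<dots> = \<zero>\<^bsub>Q\<^esub>"
      unfolding eq a_minus_def using P.T_im[OF c(2)] by (rule P.W.module.M.r_neg)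
    finally have "P (\<rho> g (x \<ominus>\<^bsub>V\<^esub> y)) = \<zero>\<^bsub>Q\<^esub>" by (rule ker[OF g cm])
    moreover have "\<rho> g (x \<ominus>\<^bsub>V\<^esub> y) = \<rho> g x \<ominus>\<^bsub>V\<^esub> \<rho> g y"
      using c by (rule mod_hom.f_minus[OF linear_map.axioms(3)[OF lin[OF g]]])
    ultimately show "P (\<rho> g x) \<ominus>\<^bsub>Q\<^esub> P (\<rho> g y) = \<zero>\<^bsub>Q\<^esub>"
      using P.T_minus[OF \<rho>c[OF g c(1)] \<rho>c[OF g c(2)]] by simp
    show "P (\<rho> g x) \<in> carrier Q" by (rule P.T_im[OF \<rho>c[OF g c(1)]])
    show "P (\<rho> g y) \<in> carrier Q" by (rule P.T_im[OF \<rho>c[OF g c(2)]])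
  qed
  define \<sigma> where "\<sigma> = (\<lambda>g. \<lambda>X\<in>carrier Q. P (\<rho> g (inv_into (carrier V) P X)))"
  have \<sigma>: "\<sigma> g (P x) = P (\<rho> g x)" if g: "g \<in> carrier G" and x: "x \<in> carrier V" for g x
  proof -
    have "P x \<in> P ` carrier V" using x by (rule imageI)
    then have "P (\<rho> g (inv_into (carrier V) P (P x))) = P (\<rho> g x)"
      by (intro well[OF g _ x] inv_into_into f_inv_into_f)
    then show ?thesis using P.T_im[OF x] by (simp add: \<sigma>_def)
  qed
  have all_Q: "B X" if "\<And>x. x \<in> carrier V \<Longrightarrow> B (P x)" "X \<in> carrier Q" for B X
    using that unfolding surj[symmetric] by (elim imageE) simp
  have \<sigma>c: "\<sigma> g X \<in> carrier Q" if "g \<in> carrier G" "X \<in> carrier Q" for g X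
    using that(2) by (rule all_Q[rotated]) (simp add: \<sigma>[OF that(1)] P.T_im \<rho>c that(1))
  have mult: "\<sigma> (g \<otimes>\<^bsub>G\<^esub> h) X = \<sigma> g (\<sigma> h X)"
    if g: "g \<in> carrier G" and h: "h \<in> carrier G" and "X \<in> carrier Q" for g h X
    using \<open>X \<in> carrier Q\<close>
  proof (rule all_Q[rotated])
    fix x assume x: "x \<in> carrier V"
    show "\<sigma> (g \<otimes>\<^bsub>G\<^esub> h) (P x) = \<sigma> g (\<sigma> h (P x))"
      using \<sigma>[OF G.m_closed[OF g h] x] \<sigma>[OF h x] \<sigma>[OF g \<rho>c[OF h x]] action_rep_mult[OF rep g h x] by simp
  qed
  have one: "\<sigma> \<one>\<^bsub>G\<^esub> X = X" if "X \<in> carrier Q" for X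
    using that
  proof (rule all_Q[rotated])
    show "\<sigma> \<one>\<^bsub>G\<^esub> (P x) = P x" if "x \<in> carrier V" for x
      using \<sigma>[OF G.one_closed that] action_rep_one[OF assms(1) rep that] by simp
  qed
  have bij: "\<sigma> g \<in> Bij (carrier Q)" if g: "g \<in> carrier G" for g
  proof -
    have g': "inv\<^bsub>G\<^esub> g \<in> carrier G" using g by (rule G.inv_closed)
    have "bij_betw (\<sigma> g) (carrier Q) (carrier Q)"
    proof (rule bij_betw_byWitness[where f' = "\<sigma> (inv\<^bsub>G\<^esub> g)"])
      show "\<forall>X\<in>carrier Q. \<sigma> (inv\<^bsub>G\<^esub> g) (\<sigma> g X) = X"
        using mult[OF g' g] one G.l_inv[OF g] by simp
      show "\<forall>X\<in>carrier Q. \<sigma> g (\<sigma> (inv\<^bsub>G\<^esub> g) X) = X"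
        using mult[OF g g'] one G.r_inv[OF g] by simp
    qed (use \<sigma>c[OF g] \<sigma>c[OF g'] in blast)+
    then show ?thesis by (simp add: Bij_def \<sigma>_def)
  qed
  have hom: "\<sigma> g \<in> module_hom F Q Q" if g: "g \<in> carrier G" for g
    unfolding module_hom_def mem_Collect_eq
  proof (intro conjI allI impI)
    show "\<sigma> g \<in> carrier Q \<rightarrow> carrier Q" using \<sigma>c[OF g] by (rule funcsetI)
  next
    fix X Y assume "X \<in> carrier Q \<and> Y \<in> carrier Q"
    then obtain x y where xy: "x \<in> carrier V" "y \<in> carrier V" "X = P x" "Y = P y"
      unfolding surj[symmetric] by (elim conjE imageE)
    have "\<sigma> g (P (x \<oplus>\<^bsub>V\<^esub> y)) = P (\<rho> g x \<oplus>\<^bsub>V\<^esub> \<rho> g y)"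
      using \<sigma>[OF g P.V.module.M.a_closed[OF xy(1,2)]]
        module_hom_add[OF mod_hom.f_hom[OF linear_map.axioms(3)[OF lin[OF g]]] xy(1,2)] by simp
    then show "\<sigma> g (X \<oplus>\<^bsub>Q\<^esub> Y) = \<sigma> g X \<oplus>\<^bsub>Q\<^esub> \<sigma> g Y"
      unfolding xy(3,4) \<sigma>[OF g xy(1)] \<sigma>[OF g xy(2)]
      using P.T_add[OF xy(1,2)] P.T_add[OF \<rho>c[OF g xy(1)] \<rho>c[OF g xy(2)]] by simp
  next
    fix a X assume "a \<in> carrier F \<and> X \<in> carrier Q"
    then obtain x where x: "a \<in> carrier F" "x \<in> carrier V" "X = P x"
      unfolding surj[symmetric] by (elim conjE imageE)
    have "\<sigma> g (P (a \<odot>\<^bsub>V\<^esub> x)) = P (a \<odot>\<^bsub>V\<^esub> \<rho> g x)"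
      using \<sigma>[OF g P.V.module.smult_closed[OF x(1,2)]]
        module_hom_smult[OF mod_hom.f_hom[OF linear_map.axioms(3)[OF lin[OF g]]] x(1,2)] by simp
    then show "\<sigma> g (a \<odot>\<^bsub>Q\<^esub> X) = a \<odot>\<^bsub>Q\<^esub> \<sigma> g X"
      unfolding x(3) \<sigma>[OF g x(2)]
      using P.T_smult[OF x(1,2)] P.T_smult[OF x(1) \<rho>c[OF g x(2)]] by simp
  qed
  have "\<sigma> \<in> hom G (GL F Q)"
  proof (rule homI)
    show "\<sigma> g \<in> carrier (GL F Q)" if "g \<in> carrier G" for g
      using bij[OF that] hom[OF that] by (simp add: GL_def)
    fix g h assume gh: "g \<in> carrier G" "h \<in> carrier G"
    have "\<sigma> (g \<otimes>\<^bsub>G\<^esub> h) = compose (carrier Q) (\<sigma> g) (\<sigma> h)"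
    proof (rule extensionalityI)
      show "\<sigma> (g \<otimes>\<^bsub>G\<^esub> h) \<in> extensional (carrier Q)" by (simp add: \<sigma>_def)
    qed (simp_all add: compose_eq mult[OF gh])
    then show "\<sigma> (g \<otimes>\<^bsub>G\<^esub> h) = \<sigma> g \<otimes>\<^bsub>GL F Q\<^esub> \<sigma> h"
      using bij[OF gh(1)] bij[OF gh(2)] by (simp add: GL_def BijGroup_def)
  qed
  moreover have "(P \<circ> \<phi>) (act g \<omega>) = \<sigma> g ((P \<circ> \<phi>) \<omega>)" if "g \<in> carrier G" "\<omega> \<in> \<Omega>" for g \<omega>
  proof -
    have "\<phi> \<omega> \<in> carrier V" "\<phi> (act g \<omega>) = \<rho> g (\<phi> \<omega>)"
      using rep that by (auto simp: action_rep_def)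
    then show ?thesis using \<sigma>[OF that(1)] by simp
  qed
  moreover have "P \<circ> \<phi> \<in> \<Omega> \<rightarrow> carrier Q"
  proof
    fix \<omega> assume "\<omega> \<in> \<Omega>"
    then have "\<phi> \<omega> \<in> carrier V" using rep by (auto simp: action_rep_def)
    then show "(P \<circ> \<phi>) \<omega> \<in> carrier Q" unfolding comp_def by (rule P.T_im)
  qed
  ultimately have "action_rep F G \<Omega> act Q \<sigma> (P \<circ> \<phi>)"
    unfolding action_rep_def using inj P.W.vectorspace_axioms by blast
  then show thesis by (rule that)
qed

text \<open>
  On a line the group acts by scalars, which commute; as \<open>\<phi>\<close> is injective and equivariant, the elements
  of the group would commute in their action on \<open>\<Omega>\<close> too.
\<close>

lemma not_one_dimensional_rep:
  assumes "group G" "group_action G \<Omega> act" "primitive_action G \<Omega> act"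
    and "\<not> cyclic_group (induced_group G \<Omega> act)"
    and rep: "action_rep F G \<Omega> act V \<rho> \<phi>"
  shows "\<not> vdim F V =o cone"
proof
  assume one: "vdim F V =o cone"
  have V: "vectorspace F V" using rep by (simp add: action_rep_def)
  interpret V: vectorspace F V by fact
  obtain v where v: "v \<in> carrier V" "\<And>x. x \<in> carrier V \<Longrightarrow> \<exists>c\<in>carrier F. x = c \<odot>\<^bsub>V\<^esub> v"
    using one unfolding V.vdim_eq_one_iff by blast
  obtain g h x where gh: "g \<in> carrier G" "h \<in> carrier G" and x: "x \<in> \<Omega>"
    and ne: "act g (act h x) \<noteq> act h (act g x)"
    using primitive_not_cyclic_imp_not_commuting[OF assms(2-4)] by blast
  have act_c: "act k y \<in> \<Omega>" if "k \<in> carrier G" "y \<in> \<Omega>" for k y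
    using group_action.element_image[OF assms(2)] that by blast
  have \<phi>: "\<phi> y \<in> carrier V" if "y \<in> \<Omega>" for y using rep that by (auto simp: action_rep_def)
  have \<phi>_act: "\<phi> (act k y) = \<rho> k (\<phi> y)" if "k \<in> carrier G" "y \<in> \<Omega>" for k y
    using rep that by (simp add: action_rep_def)
  have scalar: "\<exists>c\<in>carrier F. \<forall>y\<in>carrier V. \<rho> k y = c \<odot>\<^bsub>V\<^esub> y" if k: "k \<in> carrier G" for k
  proof -
    interpret R: linear_map F V V "\<rho> k" using rep k by (rule action_rep_linear)
    obtain c where c: "c \<in> carrier F" "\<rho> k v = c \<odot>\<^bsub>V\<^esub> v" using v(2)[OF R.T_im[OF v(1)]] by blast
    have "\<rho> k y = c \<odot>\<^bsub>V\<^esub> y" if y: "y \<in> carrier V" for y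
    proof -
      obtain d where d: "d \<in> carrier F" "y = d \<odot>\<^bsub>V\<^esub> v" using v(2)[OF y] by blast
      have "\<rho> k y = d \<odot>\<^bsub>V\<^esub> (c \<odot>\<^bsub>V\<^esub> v)" unfolding d(2) R.T_smult[OF d(1) v(1)] c(2) ..
      also have "\<dots> = c \<odot>\<^bsub>V\<^esub> y"
        unfolding d(2) V.smult_assoc1[OF c(1) d(1) v(1), symmetric]
          V.smult_assoc1[OF d(1) c(1) v(1), symmetric] V.R.m_comm[OF c(1) d(1)] ..
      finally show ?thesis .
    qed
    then show ?thesis using c(1) by blast
  qed
  obtain c d where c: "c \<in> carrier F" "\<And>y. y \<in> carrier V \<Longrightarrow> \<rho> g y = c \<odot>\<^bsub>V\<^esub> y"
    and d: "d \<in> carrier F" "\<And>y. y \<in> carrier V \<Longrightarrow> \<rho> h y = d \<odot>\<^bsub>V\<^esub> y"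
    using scalar[OF gh(1)] scalar[OF gh(2)] by blast
  note y = \<phi>[OF x]
  have "\<phi> (act g (act h x)) = c \<odot>\<^bsub>V\<^esub> (d \<odot>\<^bsub>V\<^esub> \<phi> x)"
    by (simp only: \<phi>_act gh x act_c d(2)[OF y] c(2)[OF V.smult_closed[OF d(1) y]])
  also have "\<dots> = d \<odot>\<^bsub>V\<^esub> (c \<odot>\<^bsub>V\<^esub> \<phi> x)"
    unfolding V.smult_assoc1[OF c(1) d(1) y, symmetric] V.smult_assoc1[OF d(1) c(1) y, symmetric]
      V.R.m_comm[OF c(1) d(1)] ..
  also have "\<dots> = \<phi> (act h (act g x))"
    by (simp only: \<phi>_act gh x act_c c(2)[OF y] d(2)[OF V.smult_closed[OF c(1) y]])
  finally have "\<phi> (act g (act h x)) = \<phi> (act h (act g x))" .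
  moreover have "inj_on \<phi> \<Omega>" using rep by (simp add: action_rep_def)
  ultimately show False using ne act_c gh x by (auto dest: inj_onD)
qed

section \<open>Linear maps out of the permutation module\<close>

lemma linear_map_eq_on_span:
  assumes A: "linear_map F V Q A" and B: "linear_map F V Q B"
    and X: "X \<subseteq> carrier V" "\<And>x. x \<in> X \<Longrightarrow> A x = B x"
    and v: "v \<in> module.span F V X"
  shows "A v = B v"
proof -
  interpret A: linear_map F V Q A by fact
  interpret B: linear_map F V Q B by fact
  have "submodule F {v \<in> carrier V. A v = B v} V"
  proof (rule LinearCombinations.submodule.intro)
    show "module F V" by (rule A.V.module.module_axioms)
    show "v \<oplus>\<^bsub>V\<^esub> w \<in> {v \<in> carrier V. A v = B v}"
      if "v \<in> {v \<in> carrier V. A v = B v}" "w \<in> {v \<in> carrier V. A v = B v}" for v w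
      using that A.T_add[of v w] B.T_add[of v w] A.V.module.M.a_closed[of v w] by simp
    show "c \<odot>\<^bsub>V\<^esub> v \<in> {v \<in> carrier V. A v = B v}"
      if "c \<in> carrier F" "v \<in> {v \<in> carrier V. A v = B v}" for c v
      using that A.T_smult[of c v] B.T_smult[of c v] A.V.module.smult_closed[of c v] by simp
  qed (use A.T0_is_0 B.T0_is_0 in simp_all)
  moreover have "X \<subseteq> {v \<in> carrier V. A v = B v}" using X by blast
  ultimately show ?thesis using A.V.module.span_is_subset v by blast
qed

text \<open>
  By induction on the size of the support: clearing the value of \<open>f\<close> at \<open>a\<close> subtracts a multiple
  of \<open>perm_unit F \<Omega> a\<close>.
\<close>

lemma perm_unit_span:
  fixes F :: "('f, 'r) ring_scheme" and \<Omega> :: "'w set"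
  assumes "field F"
  shows "module.span F (perm_module F \<Omega>) (perm_unit F \<Omega> ` \<Omega>) = carrier (perm_module F \<Omega>)"
proof -
  interpret F: field F by fact
  interpret M: vectorspace F "perm_module F \<Omega>" by (rule vectorspace_perm_module) fact
  note S = perm_module_simps[OF assms]
  let ?M = "perm_module F \<Omega>"
  have units: "perm_unit F \<Omega> ` \<Omega> \<subseteq> carrier ?M"
    by (auto simp: S perm_unit_def cong: conj_cong)
  let ?N = "M.module.span (perm_unit F \<Omega> ` \<Omega>)"
  interpret N: submodule F ?N ?M using units by (rule M.module.span_is_submodule)
  have "f \<in> ?N" if "finite A" "f \<in> carrier ?M" "{\<omega>\<in>\<Omega>. f \<omega> \<noteq> \<zero>\<^bsub>F\<^esub>} = A" for f A
    using that
  proof (induction A arbitrary: f)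
    case empty
    then have "f = \<zero>\<^bsub>?M\<^esub>" by (auto simp: S PiE_iff extensional_def fun_eq_iff restrict_def)
    then show ?case using N.zero_closed by simp
  next
    case (insert a A)
    have a: "a \<in> \<Omega>" using insert.prems(2) by blast
    have fc: "f \<omega> \<in> carrier F" if "\<omega> \<in> \<Omega>" for \<omega>
      using insert.prems(1) that unfolding S by blast
    define h where "h = (\<lambda>\<omega>\<in>\<Omega>. if \<omega> = a then \<zero>\<^bsub>F\<^esub> else f \<omega>)"
    have supp: "{\<omega>\<in>\<Omega>. h \<omega> \<noteq> \<zero>\<^bsub>F\<^esub>} = A"
      using insert.prems(2) insert.hyps(2) by (auto simp: h_def)
    have h: "h \<in> carrier ?M"
      unfolding S using supp insert.hyps(1) fc by (auto simp: h_def)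
    have "h \<oplus>\<^bsub>?M\<^esub> (f a \<odot>\<^bsub>?M\<^esub> perm_unit F \<Omega> a) = f"
    proof (rule extensionalityI)
      show "f \<in> extensional \<Omega>" using insert.prems(1) unfolding S by (simp add: PiE_def)
      show "h \<oplus>\<^bsub>?M\<^esub> (f a \<odot>\<^bsub>?M\<^esub> perm_unit F \<Omega> a) \<in> extensional \<Omega>" by (simp add: S)
      show "(h \<oplus>\<^bsub>?M\<^esub> (f a \<odot>\<^bsub>?M\<^esub> perm_unit F \<Omega> a)) \<omega> = f \<omega>" if "\<omega> \<in> \<Omega>" for \<omega>
        using that fc[OF that] fc[OF a] by (simp add: S h_def perm_unit_def)
    qed
    moreover have "perm_unit F \<Omega> a \<in> ?N" using M.module.in_own_span[OF units] a by blast
    then have "f a \<odot>\<^bsub>?M\<^esub> perm_unit F \<Omega> a \<in> ?N" by (rule N.smult_closed[OF fc[OF a]])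
    ultimately show ?case using N.m_closed[OF insert.IH[OF h supp]] by metis
  qed
  then have "carrier ?M \<subseteq> ?N" by (auto simp: S)
  then show ?thesis using N.subset by blast
qed

text \<open>
  The linear extension of \<open>\<phi>\<close> to the permutation module, \<open>e\<^sub>\<omega> \<mapsto> \<phi> \<omega>\<close>.
\<close>

definition perm_lift ::
    "('f, 'r) ring_scheme \<Rightarrow> 'w set \<Rightarrow> ('f, 'v, 's) module_scheme \<Rightarrow> ('w \<Rightarrow> 'v) \<Rightarrow> ('w \<Rightarrow> 'f) \<Rightarrow> 'v" where
  "perm_lift F \<Omega> V \<phi> f = (\<Oplus>\<^bsub>V\<^esub>\<omega>\<in>{\<omega>\<in>\<Omega>. f \<omega> \<noteq> \<zero>\<^bsub>F\<^esub>}. f \<omega> \<odot>\<^bsub>V\<^esub> \<phi> \<omega>)"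

text \<open>
  Enlarging the range of summation makes sums over the supports of different functions comparable.
\<close>

lemma perm_lift_eq_finsum:
  assumes "vectorspace F V" "\<phi> \<in> \<Omega> \<rightarrow> carrier V" "f \<in> carrier (perm_module F \<Omega>)"
    and "finite S" "S \<subseteq> \<Omega>" "{\<omega>\<in>\<Omega>. f \<omega> \<noteq> \<zero>\<^bsub>F\<^esub>} \<subseteq> S"
  shows "perm_lift F \<Omega> V \<phi> f = (\<Oplus>\<^bsub>V\<^esub>\<omega>\<in>S. f \<omega> \<odot>\<^bsub>V\<^esub> \<phi> \<omega>)"
  unfolding perm_lift_def
proof -
  interpret V: vectorspace F V by fact
  have fc: "f \<omega> \<in> carrier F" if "\<omega> \<in> \<Omega>" for \<omega>
    using assms(3) that unfolding perm_module_simps[OF V.field_axioms] by blast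
  show "(\<Oplus>\<^bsub>V\<^esub>\<omega>\<in>{\<omega>\<in>\<Omega>. f \<omega> \<noteq> \<zero>\<^bsub>F\<^esub>}. f \<omega> \<odot>\<^bsub>V\<^esub> \<phi> \<omega>) = (\<Oplus>\<^bsub>V\<^esub>\<omega>\<in>S. f \<omega> \<odot>\<^bsub>V\<^esub> \<phi> \<omega>)"
  proof (rule V.M.add.finprod_mono_neutral_cong_left[OF assms(4,6)])
    show "f \<omega> \<odot>\<^bsub>V\<^esub> \<phi> \<omega> = \<zero>\<^bsub>V\<^esub>" if \<omega>: "\<omega> \<in> S - {\<omega>\<in>\<Omega>. f \<omega> \<noteq> \<zero>\<^bsub>F\<^esub>}" for \<omega>
    proof -
      have "\<omega> \<in> \<Omega>" "f \<omega> = \<zero>\<^bsub>F\<^esub>" using \<omega> assms(5) by auto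
      then show ?thesis using funcset_mem[OF assms(2)] by (simp add: V.smult_l_null)
    qed
    show "(\<lambda>\<omega>. f \<omega> \<odot>\<^bsub>V\<^esub> \<phi> \<omega>) \<in> S \<rightarrow> carrier V"
      using V.smult_closed[OF fc funcset_mem[OF assms(2)]] assms(5) by blast
  qed simp
qed

lemma linear_map_perm_lift:
  fixes F :: "('f, 'r) ring_scheme" and \<Omega> :: "'w set"
  assumes "vectorspace F V" and \<phi>: "\<phi> \<in> \<Omega> \<rightarrow> carrier V"
  shows "linear_map F (perm_module F \<Omega>) V (perm_lift F \<Omega> V \<phi>)"
proof -
  interpret V: vectorspace F V by fact
  interpret M: vectorspace F "perm_module F \<Omega>" by (rule vectorspace_perm_module[OF V.field_axioms])
  let ?M = "perm_module F \<Omega>" and ?T = "perm_lift F \<Omega> V \<phi>"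
  note S = perm_module_simps[OF V.field_axioms]
  define supp where "supp = (\<lambda>f. {\<omega>\<in>\<Omega>. f \<omega> \<noteq> \<zero>\<^bsub>F\<^esub>})"
  have fc: "f \<omega> \<in> carrier F" if "f \<in> carrier ?M" "\<omega> \<in> \<Omega>" for f \<omega>
    using that unfolding S by blast
  have fin: "finite (supp f)" "supp f \<subseteq> \<Omega>" if "f \<in> carrier ?M" for f
    using that unfolding S supp_def by auto
  have summand: "(\<lambda>\<omega>. f \<omega> \<odot>\<^bsub>V\<^esub> \<phi> \<omega>) \<in> A \<rightarrow> carrier V" if "f \<in> carrier ?M" "A \<subseteq> \<Omega>" for f A
    using V.smult_closed[OF fc[OF that(1)] funcset_mem[OF \<phi>]] that(2) by blast
  have lift: "?T f = (\<Oplus>\<^bsub>V\<^esub>\<omega>\<in>A. f \<omega> \<odot>\<^bsub>V\<^esub> \<phi> \<omega>)"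
    if "f \<in> carrier ?M" "finite A" "A \<subseteq> \<Omega>" "supp f \<subseteq> A" for f A
    using perm_lift_eq_finsum[OF assms that(1-3)] that(4) by (simp add: supp_def)
  have "?T \<in> module_hom F ?M V"
    unfolding module_hom_def mem_Collect_eq
  proof (intro conjI allI impI)
    show "?T \<in> carrier ?M \<rightarrow> carrier V"
    proof
      fix f assume f: "f \<in> carrier ?M"
      show "?T f \<in> carrier V"
        unfolding lift[OF f fin[OF f] subset_refl]
        using summand[OF f fin(2)[OF f]] by (rule V.M.finsum_closed)
    qed
  next
    fix f h assume "f \<in> carrier ?M \<and> h \<in> carrier ?M"
    then have f: "f \<in> carrier ?M" and h: "h \<in> carrier ?M" by auto
    define A where "A = supp f \<union> supp h"
    have A: "finite A" "A \<subseteq> \<Omega>" "supp f \<subseteq> A" "supp h \<subseteq> A" using fin[OF f] fin[OF h] by (auto simp: A_def)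
    have fh: "f \<oplus>\<^bsub>?M\<^esub> h \<in> carrier ?M" using f h by (rule M.M.a_closed)
    have "supp (f \<oplus>\<^bsub>?M\<^esub> h) \<subseteq> A"
      by (auto simp: A_def supp_def S)
    then have "?T (f \<oplus>\<^bsub>?M\<^esub> h) = (\<Oplus>\<^bsub>V\<^esub>\<omega>\<in>A. (f \<oplus>\<^bsub>?M\<^esub> h) \<omega> \<odot>\<^bsub>V\<^esub> \<phi> \<omega>)"
      by (rule lift[OF fh A(1,2)])
    also have "\<dots> = (\<Oplus>\<^bsub>V\<^esub>\<omega>\<in>A. f \<omega> \<odot>\<^bsub>V\<^esub> \<phi> \<omega> \<oplus>\<^bsub>V\<^esub> h \<omega> \<odot>\<^bsub>V\<^esub> \<phi> \<omega>)"
    proof (rule V.M.finsum_cong'[OF refl])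
      show "(\<lambda>\<omega>. f \<omega> \<odot>\<^bsub>V\<^esub> \<phi> \<omega> \<oplus>\<^bsub>V\<^esub> h \<omega> \<odot>\<^bsub>V\<^esub> \<phi> \<omega>) \<in> A \<rightarrow> carrier V"
        using V.M.a_closed[OF funcset_mem[OF summand[OF f A(2)]] funcset_mem[OF summand[OF h A(2)]]] by blast
      show "(f \<oplus>\<^bsub>?M\<^esub> h) \<omega> \<odot>\<^bsub>V\<^esub> \<phi> \<omega> = f \<omega> \<odot>\<^bsub>V\<^esub> \<phi> \<omega> \<oplus>\<^bsub>V\<^esub> h \<omega> \<odot>\<^bsub>V\<^esub> \<phi> \<omega>" if "\<omega> \<in> A" for \<omega>
      proof -
        have \<omega>: "\<omega> \<in> \<Omega>" using that A(2) by blast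
        have "(f \<oplus>\<^bsub>?M\<^esub> h) \<omega> = f \<omega> \<oplus>\<^bsub>F\<^esub> h \<omega>" using \<omega> by (simp add: S)
        then show ?thesis
          using V.smult_l_distr[OF fc[OF f \<omega>] fc[OF h \<omega>] funcset_mem[OF \<phi> \<omega>]] by simp
      qed
    qed
    also have "\<dots> = ?T f \<oplus>\<^bsub>V\<^esub> ?T h"
      unfolding lift[OF f A(1,2,3)] lift[OF h A(1,2,4)]
      by (rule V.M.finsum_addf[OF summand[OF f A(2)] summand[OF h A(2)]])
    finally show "?T (f \<oplus>\<^bsub>?M\<^esub> h) = ?T f \<oplus>\<^bsub>V\<^esub> ?T h" .
  next
    fix c f assume "c \<in> carrier F \<and> f \<in> carrier ?M"
    then have c: "c \<in> carrier F" and f: "f \<in> carrier ?M" by auto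
    have cf: "c \<odot>\<^bsub>?M\<^esub> f \<in> carrier ?M" using c f by (rule M.smult_closed)
    have "(c \<odot>\<^bsub>?M\<^esub> f) \<omega> = \<zero>\<^bsub>F\<^esub>" if "\<omega> \<in> \<Omega>" "f \<omega> = \<zero>\<^bsub>F\<^esub>" for \<omega>
      using that c by (simp add: S)
    then have "supp (c \<odot>\<^bsub>?M\<^esub> f) \<subseteq> supp f" unfolding supp_def by blast
    then have "?T (c \<odot>\<^bsub>?M\<^esub> f) = (\<Oplus>\<^bsub>V\<^esub>\<omega>\<in>supp f. (c \<odot>\<^bsub>?M\<^esub> f) \<omega> \<odot>\<^bsub>V\<^esub> \<phi> \<omega>)"
      by (rule lift[OF cf fin[OF f]])
    also have "\<dots> = (\<Oplus>\<^bsub>V\<^esub>\<omega>\<in>supp f. c \<odot>\<^bsub>V\<^esub> (f \<omega> \<odot>\<^bsub>V\<^esub> \<phi> \<omega>))"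
    proof (rule V.M.finsum_cong'[OF refl])
      show "(\<lambda>\<omega>. c \<odot>\<^bsub>V\<^esub> (f \<omega> \<odot>\<^bsub>V\<^esub> \<phi> \<omega>)) \<in> supp f \<rightarrow> carrier V"
        using V.smult_closed[OF c funcset_mem[OF summand[OF f fin(2)[OF f]]]] by blast
      show "(c \<odot>\<^bsub>?M\<^esub> f) \<omega> \<odot>\<^bsub>V\<^esub> \<phi> \<omega> = c \<odot>\<^bsub>V\<^esub> (f \<omega> \<odot>\<^bsub>V\<^esub> \<phi> \<omega>)" if "\<omega> \<in> supp f" for \<omega>
      proof -
        have \<omega>: "\<omega> \<in> \<Omega>" using that fin(2)[OF f] by blast
        have "(c \<odot>\<^bsub>?M\<^esub> f) \<omega> = c \<otimes>\<^bsub>F\<^esub> f \<omega>" using \<omega> by (simp add: S)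
        then show ?thesis using V.smult_assoc1[OF c fc[OF f \<omega>] funcset_mem[OF \<phi> \<omega>]] by simp
      qed
    qed
    also have "\<dots> = c \<odot>\<^bsub>V\<^esub> ?T f"
      unfolding lift[OF f fin[OF f] subset_refl]
      by (rule V.finsum_smult_ldistr[OF fin(1)[OF f] c summand[OF f fin(2)[OF f]], symmetric])
    finally show "?T (c \<odot>\<^bsub>?M\<^esub> f) = c \<odot>\<^bsub>V\<^esub> ?T f" .
  qed
  then show ?thesis
    using M.vectorspace_axioms V.vectorspace_axioms by (intro linear_mapI)
qed

lemma perm_lift_perm_unit:
  assumes "vectorspace F V" "\<phi> \<in> \<Omega> \<rightarrow> carrier V" "\<omega> \<in> \<Omega>"
  shows "perm_lift F \<Omega> V \<phi> (perm_unit F \<Omega> \<omega>) = \<phi> \<omega>"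
proof -
  interpret V: vectorspace F V by fact
  have \<phi>: "\<phi> \<omega> \<in> carrier V" using assms(2,3) by (rule funcset_mem)
  have supp: "{x\<in>\<Omega>. perm_unit F \<Omega> \<omega> x \<noteq> \<zero>\<^bsub>F\<^esub>} = {\<omega>}"
    using assms(3) V.one_not_zero by (auto simp: perm_unit_def)
  have one: "perm_unit F \<Omega> \<omega> \<omega> = \<one>\<^bsub>F\<^esub>" using assms(3) by (simp add: perm_unit_def)
  show ?thesis
    unfolding perm_lift_def supp using \<phi> by (simp add: one V.smult_one)
qed

text \<open>
  Both sides are linear in \<open>f\<close>, and for the unit vectors the equation is the equivariance of \<open>\<phi>\<close>.
\<close>

lemma perm_lift_equivariant:
  assumes "field F" "group G" "group_action G \<Omega> act"
    and rep: "action_rep F G \<Omega> act V \<rho> \<phi>"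
    and g: "g \<in> carrier G" and f: "f \<in> carrier (perm_module F \<Omega>)"
  shows "perm_lift F \<Omega> V \<phi> (perm_rep F G \<Omega> act g f) = \<rho> g (perm_lift F \<Omega> V \<phi> f)"
proof -
  let ?M = "perm_module F \<Omega>" and ?T = "perm_lift F \<Omega> V \<phi>" and ?u = "perm_unit F \<Omega>"
  have V: "vectorspace F V" and \<phi>: "\<phi> \<in> \<Omega> \<rightarrow> carrier V"
    and \<phi>_act: "\<And>\<omega>. \<omega> \<in> \<Omega> \<Longrightarrow> \<phi> (act g \<omega>) = \<rho> g (\<phi> \<omega>)"
    using rep g by (auto simp: action_rep_def)
  have T: "linear_map F ?M V ?T" using V \<phi> by (rule linear_map_perm_lift)
  have perm: "linear_map F ?M ?M (perm_rep F G \<Omega> act g)"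
    using action_rep_perm_module[OF assms(1-3)] g by (rule action_rep_linear)
  have \<rho>: "linear_map F V V (\<rho> g)" using rep g by (rule action_rep_linear)
  have act_c: "act g \<omega> \<in> \<Omega>" if "\<omega> \<in> \<Omega>" for \<omega>
    using group_action.element_image[OF assms(3) g that refl] .
  have "?T (perm_rep F G \<Omega> act g x) = \<rho> g (?T x)" if x: "x \<in> ?u ` \<Omega>" for x
  proof -
    obtain \<omega> where \<omega>: "\<omega> \<in> \<Omega>" "x = ?u \<omega>" using x by blast
    show ?thesis
      unfolding \<omega>(2) perm_rep_perm_unit(2)[OF assms(1-3) g \<omega>(1)]
        perm_lift_perm_unit[OF V \<phi> \<omega>(1)] perm_lift_perm_unit[OF V \<phi> act_c[OF \<omega>(1)]]
      by (rule \<phi>_act[OF \<omega>(1)])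
  qed
  moreover have "?u ` \<Omega> \<subseteq> carrier ?M" using perm_rep_perm_unit(1)[OF assms(1-3) g] by blast
  moreover have "f \<in> module.span F ?M (?u ` \<Omega>)" using f unfolding perm_unit_span[OF assms(1)] .
  ultimately show ?thesis
    using linear_map_eq_on_span[OF linear_map_comp[OF perm T] linear_map_comp[OF T \<rho>]] by blast
qed

section \<open>Submodules and congruent generators\<close>

lemma quotient_map_eq_iff:
  assumes V: "vectorspace F V" and W: "submodule F W V" and "x \<in> carrier V" "y \<in> carrier V"
  shows "W +>\<^bsub>V\<^esub> x = W +>\<^bsub>V\<^esub> y \<longleftrightarrow> x \<ominus>\<^bsub>V\<^esub> y \<in> W"
proof -
  interpret P: linear_map F V "quotient_space V W" "\<lambda>x. W +>\<^bsub>V\<^esub> x"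
    using V W by (rule linear_map_quotient)
  have c: "x \<ominus>\<^bsub>V\<^esub> y \<in> carrier V"
    using assms(3,4) by (rule abelian_group.minus_closed[OF P.V.module.M.abelian_group_axioms])
  have diff: "W +>\<^bsub>V\<^esub> (x \<ominus>\<^bsub>V\<^esub> y) = (W +>\<^bsub>V\<^esub> x) \<ominus>\<^bsub>quotient_space V W\<^esub> (W +>\<^bsub>V\<^esub> y)"
    using assms(3,4) by (rule P.T_minus)
  show ?thesis
  proof
    assume "x \<ominus>\<^bsub>V\<^esub> y \<in> W"
    then have "W +>\<^bsub>V\<^esub> (x \<ominus>\<^bsub>V\<^esub> y) = \<zero>\<^bsub>quotient_space V W\<^esub>"
      using quotient_map_eq_zero_iff[OF V W c] by simp
    then show "W +>\<^bsub>V\<^esub> x = W +>\<^bsub>V\<^esub> y"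
      unfolding diff
      by (rule abelian_group.eq_of_minus_eq_zero[OF P.W.module.M.abelian_group_axioms
            P.T_im[OF assms(3)] P.T_im[OF assms(4)]])
  next
    assume eq: "W +>\<^bsub>V\<^esub> x = W +>\<^bsub>V\<^esub> y"
    note diff
    also have "(W +>\<^bsub>V\<^esub> x) \<ominus>\<^bsub>quotient_space V W\<^esub> (W +>\<^bsub>V\<^esub> y) = \<zero>\<^bsub>quotient_space V W\<^esub>"
      unfolding eq a_minus_def using P.T_im[OF assms(4)] by (rule P.W.module.M.r_neg)
    finally show "x \<ominus>\<^bsub>V\<^esub> y \<in> W" using quotient_map_eq_zero_iff[OF V W c] by simp
  qed
qed

text \<open>
  The vectors that \<open>P\<close> sends into the line of \<open>P x0\<close> form a subspace containing the generators.
\<close>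

lemma linear_map_in_line_of_const_on_span:
  assumes "linear_map F V Q P" and X: "X \<subseteq> carrier V" "module.span F V X = carrier V"
    and x0: "x0 \<in> X" "\<And>x. x \<in> X \<Longrightarrow> P x = P x0"
    and v: "v \<in> carrier V"
  shows "\<exists>c\<in>carrier F. P v = c \<odot>\<^bsub>Q\<^esub> P x0"
proof -
  interpret V: vectorspace F V using assms(1) by (rule linear_map.axioms(1))
  interpret Q: vectorspace F Q using assms(1) by (rule linear_map.axioms(2))
  interpret P: linear_map F V Q P by fact
  let ?S = "{v \<in> carrier V. \<exists>c\<in>carrier F. P v = c \<odot>\<^bsub>Q\<^esub> P x0}"
  have Px0: "P x0 \<in> carrier Q" using X(1) x0(1) P.T_im by blast
  have "submodule F ?S V"
  proof (rule LinearCombinations.submodule.intro)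
    show "module F V" by (rule V.module_axioms)
    show "\<zero>\<^bsub>V\<^esub> \<in> ?S"
      using P.T0_is_0 Q.smult_l_null[OF Px0] V.R.zero_closed V.M.zero_closed
      by (intro CollectI conjI bexI[of _ "\<zero>\<^bsub>F\<^esub>"]) simp_all
    show "v \<oplus>\<^bsub>V\<^esub> w \<in> ?S" if vS: "v \<in> ?S" and wS: "w \<in> ?S" for v w
    proof -
      obtain c where c: "c \<in> carrier F" "P v = c \<odot>\<^bsub>Q\<^esub> P x0" using vS by blast
      obtain d where d: "d \<in> carrier F" "P w = d \<odot>\<^bsub>Q\<^esub> P x0" using wS by blast
      have vw: "v \<in> carrier V" "w \<in> carrier V" using vS wS by blast+
      have "P (v \<oplus>\<^bsub>V\<^esub> w) = (c \<oplus>\<^bsub>F\<^esub> d) \<odot>\<^bsub>Q\<^esub> P x0"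
        unfolding P.T_add[OF vw] c(2) d(2) Q.smult_l_distr[OF c(1) d(1) Px0] ..
      then show ?thesis
        using V.R.a_closed[OF c(1) d(1)] V.M.a_closed[OF vw] by blast
    qed
    show "a \<odot>\<^bsub>V\<^esub> v \<in> ?S" if a: "a \<in> carrier F" and vS: "v \<in> ?S" for a v
    proof -
      obtain c where c: "c \<in> carrier F" "P v = c \<odot>\<^bsub>Q\<^esub> P x0" using vS by blast
      have v: "v \<in> carrier V" using vS by blast
      have "P (a \<odot>\<^bsub>V\<^esub> v) = (a \<otimes>\<^bsub>F\<^esub> c) \<odot>\<^bsub>Q\<^esub> P x0"
        unfolding P.T_smult[OF a v] c(2) Q.smult_assoc1[OF a c(1) Px0] ..
      then show ?thesis
        using V.R.m_closed[OF a c(1)] V.smult_closed[OF a v] by blast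
    qed
  qed blast
  moreover have "X \<subseteq> ?S"
  proof
    fix x assume x: "x \<in> X"
    have "P x = \<one>\<^bsub>F\<^esub> \<odot>\<^bsub>Q\<^esub> P x0" using x0(2)[OF x] Q.smult_one[OF Px0] by simp
    then show "x \<in> ?S" using x X(1) V.R.one_closed by blast
  qed
  ultimately have "carrier V \<subseteq> ?S" using V.span_is_subset unfolding X(2)[symmetric] by blast
  then show ?thesis using v by blast
qed

text \<open>
  Modulo \<open>W\<close> all generators become equal to \<open>x0\<close>, so the quotient is the line spanned by the class
  of \<open>x0\<close>; this class is not zero since \<open>W\<close> is proper.
\<close>

lemma codim_one_of_congruent_generators:
  assumes V: "vectorspace F V" and W: "submodule F W V" "W \<noteq> carrier V"
    and X: "X \<subseteq> carrier V" "module.span F V X = carrier V"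
    and x0: "x0 \<in> X" "\<And>x. x \<in> X \<Longrightarrow> x \<ominus>\<^bsub>V\<^esub> x0 \<in> W"
  shows "codim F V W =o cone" and "x0 \<notin> W"
    and "v \<in> carrier V \<Longrightarrow> \<exists>c\<in>carrier F. v \<ominus>\<^bsub>V\<^esub> (c \<odot>\<^bsub>V\<^esub> x0) \<in> W"
proof -
  let ?Q = "quotient_space V W" and ?P = "\<lambda>x. W +>\<^bsub>V\<^esub> x"
  have lin: "linear_map F V ?Q ?P" using V W(1) by (rule linear_map_quotient)
  interpret P: linear_map F V ?Q ?P by (rule lin)
  have x0c: "x0 \<in> carrier V" using X(1) x0(1) by blast
  have line: "\<exists>c\<in>carrier F. ?P v = c \<odot>\<^bsub>?Q\<^esub> ?P x0" if "v \<in> carrier V" for v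
    using lin X x0(1) _ that
  proof (rule linear_map_in_line_of_const_on_span)
    show "?P x = ?P x0" if "x \<in> X" for x
      using quotient_map_eq_iff[OF V W(1) _ x0c] X(1) x0(2) that by blast
  qed
  have nonzero: "?P x0 \<noteq> \<zero>\<^bsub>?Q\<^esub>"
  proof
    assume zero: "?P x0 = \<zero>\<^bsub>?Q\<^esub>"
    have "v \<in> W" if v: "v \<in> carrier V" for v
    proof -
      obtain c where c: "c \<in> carrier F" "?P v = c \<odot>\<^bsub>?Q\<^esub> ?P x0" using line[OF v] by blast
      have "?P v = \<zero>\<^bsub>?Q\<^esub>" unfolding c(2) zero using c(1) by (rule P.W.module.smult_r_null)
      then show ?thesis using quotient_map_eq_zero_iff[OF V W(1) v] by simp
    qed
    moreover have "W \<subseteq> carrier V" using W(1) by (simp add: submodule_def)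
    ultimately show False using W(2) by blast
  qed
  then show "x0 \<notin> W" using quotient_map_eq_zero_iff[OF V W(1) x0c] by simp
  have "\<exists>c\<in>carrier F. X = c \<odot>\<^bsub>?Q\<^esub> ?P x0" if "X \<in> carrier ?Q" for X
    using that line unfolding quotient_map_surj[OF V W(1), symmetric] by blast
  then have "vdim F ?Q =o cone"
    unfolding P.W.vdim_eq_one_iff using nonzero P.T_im[OF x0c] by blast
  then show "codim F V W =o cone" by (simp add: codim_def)
  show "\<exists>c\<in>carrier F. v \<ominus>\<^bsub>V\<^esub> (c \<odot>\<^bsub>V\<^esub> x0) \<in> W" if v: "v \<in> carrier V"
  proof -
    obtain c where c: "c \<in> carrier F" "?P v = c \<odot>\<^bsub>?Q\<^esub> ?P x0" using line[OF v] by blast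
    have cx: "c \<odot>\<^bsub>V\<^esub> x0 \<in> carrier V" using c(1) x0c by (rule P.V.module.smult_closed)
    have "?P v = ?P (c \<odot>\<^bsub>V\<^esub> x0)" unfolding c(2) P.T_smult[OF c(1) x0c] ..
    then show ?thesis using quotient_map_eq_iff[OF V W(1) v cx] c(1) by blast
  qed
qed

lemma codim_less_vdim:
  assumes V: "vectorspace F V" "vdim F V <o natLeq" and W: "submodule F W V" "W \<noteq> {\<zero>\<^bsub>V\<^esub>}"
  shows "codim F V W <o vdim F V"
proof -
  interpret V: vectorspace F V by fact
  interpret W: submodule F W V by fact
  obtain y where y: "y \<in> W" "y \<noteq> \<zero>\<^bsub>V\<^esub>" using W(2) W.zero_closed by blast
  have id: "linear_map F V V (\<lambda>x. x)"
    using V(1) by (intro linear_mapI) (simp_all add: module_hom_def)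
  note P = linear_map_quotient[OF V(1) W(1)] quotient_map_surj[OF V(1) W(1)]
  show ?thesis
    unfolding codim_def
  proof (rule vdim_less_of_ker_le[OF P(1) id P(2) _ V(2)])
    show "y \<in> carrier V" "y \<noteq> \<zero>\<^bsub>V\<^esub>" using y W.subset by auto
    show "W +>\<^bsub>V\<^esub> x = \<zero>\<^bsub>quotient_space V W\<^esub>" if "x \<in> carrier V" "x = \<zero>\<^bsub>V\<^esub>" for x
      using quotient_map_eq_zero_iff[OF V(1) W(1) that(1)] that(2) W.zero_closed by simp
    show "W +>\<^bsub>V\<^esub> x = \<zero>\<^bsub>quotient_space V W\<^esub>" if "x \<in> carrier V" "x = y" for x
      using quotient_map_eq_zero_iff[OF V(1) W(1) that(1)] that(2) y(1) by simp
  qed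
qed

lemma action_rep_quotient:
  assumes "group G" "action_rep F G \<Omega> act V \<rho> \<phi>" "FG_submodule F G V \<rho> W"
    and inj: "inj_on (\<lambda>\<omega>. W +>\<^bsub>V\<^esub> \<phi> \<omega>) \<Omega>"
  obtains \<sigma> where "action_rep F G \<Omega> act (quotient_space V W) \<sigma> (\<lambda>\<omega>. W +>\<^bsub>V\<^esub> \<phi> \<omega>)"
proof -
  let ?Q = "quotient_space V W" and ?P = "\<lambda>x. W +>\<^bsub>V\<^esub> x"
  have V: "vectorspace F V" using assms(2) by (simp add: action_rep_def)
  have W: "submodule F W V" using assms(3) by (simp add: FG_submodule_def)
  have ker: "?P (\<rho> g x) = \<zero>\<^bsub>?Q\<^esub>" if g: "g \<in> carrier G" and x: "x \<in> carrier V" "?P x = \<zero>\<^bsub>?Q\<^esub>" for g x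
  proof -
    have "x \<in> W" using quotient_map_eq_zero_iff[OF V W x(1)] x(2) by simp
    then have "\<rho> g x \<in> W" using assms(3) g by (simp add: FG_submodule_def)
    moreover have "\<rho> g x \<in> carrier V"
      using x(1) by (rule mod_hom.f_im[OF linear_map.axioms(3)[OF action_rep_linear[OF assms(2) g]]])
    ultimately show ?thesis using quotient_map_eq_zero_iff[OF V W] by blast
  qed
  have inj': "inj_on (?P \<circ> \<phi>) \<Omega>" using inj by (simp add: comp_def)
  obtain \<sigma> where "action_rep F G \<Omega> act ?Q \<sigma> (?P \<circ> \<phi>)"
    using assms(1,2) linear_map_quotient[OF V W] quotient_map_surj[OF V W] ker inj'
    by (rule action_rep_linear_image)
  then show thesis using that by (simp add: comp_def)
qed

text \<open>
  The map \<open>\<omega> \<mapsto> \<phi> \<omega> + W\<close> is equivariant, so its fibres are permuted by the group, and primitivity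
  makes it injective or constant.
\<close>

lemma primitive_quotient_dichotomy:
  assumes "group_action G \<Omega> act" "primitive_action G \<Omega> act"
    and rep: "action_rep F G \<Omega> act V \<rho> \<phi>" and W: "FG_submodule F G V \<rho> W"
  shows "inj_on (\<lambda>\<omega>. W +>\<^bsub>V\<^esub> \<phi> \<omega>) \<Omega> \<or> (\<forall>x\<in>\<Omega>. \<forall>y\<in>\<Omega>. \<phi> x \<ominus>\<^bsub>V\<^esub> \<phi> y \<in> W)"
proof -
  have V: "vectorspace F V" and \<phi>_fun: "\<phi> \<in> \<Omega> \<rightarrow> carrier V"
    using rep by (simp_all add: action_rep_def)
  have \<phi>: "\<phi> x \<in> carrier V" if "x \<in> \<Omega>" for x using \<phi>_fun that by (rule funcset_mem)
  have \<phi>_act: "\<phi> (act g x) = \<rho> g (\<phi> x)" if "g \<in> carrier G" "x \<in> \<Omega>" for g x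
    using rep that by (simp add: action_rep_def)
  have sub: "submodule F W V" and inv: "\<And>g w. g \<in> carrier G \<Longrightarrow> w \<in> W \<Longrightarrow> \<rho> g w \<in> W"
    using W by (simp_all add: FG_submodule_def)
  note eq_iff = quotient_map_eq_iff[OF V sub]
  have act_c: "act g x \<in> \<Omega>" if "g \<in> carrier G" "x \<in> \<Omega>" for g x
    using group_action.element_image[OF assms(1) that refl] .
  have "inj_on (\<lambda>\<omega>. W +>\<^bsub>V\<^esub> \<phi> \<omega>) \<Omega> \<or> (\<forall>x\<in>\<Omega>. \<forall>y\<in>\<Omega>. W +>\<^bsub>V\<^esub> \<phi> x = W +>\<^bsub>V\<^esub> \<phi> y)"
  proof (rule primitive_invariant_function[OF assms(1,2)])
    fix g x y assume g: "g \<in> carrier G" and x: "x \<in> \<Omega>" and y: "y \<in> \<Omega>"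
      and eq: "W +>\<^bsub>V\<^esub> \<phi> x = W +>\<^bsub>V\<^esub> \<phi> y"
    have "\<phi> x \<ominus>\<^bsub>V\<^esub> \<phi> y \<in> W" using eq eq_iff[OF \<phi>[OF x] \<phi>[OF y]] by simp
    then have "\<rho> g (\<phi> x \<ominus>\<^bsub>V\<^esub> \<phi> y) \<in> W" by (rule inv[OF g])
    then have "\<phi> (act g x) \<ominus>\<^bsub>V\<^esub> \<phi> (act g y) \<in> W"
      unfolding \<phi>_act[OF g x] \<phi>_act[OF g y]
        mod_hom.f_minus[OF linear_map.axioms(3)[OF action_rep_linear[OF rep g]] \<phi>[OF x] \<phi>[OF y]] .
    then show "W +>\<^bsub>V\<^esub> \<phi> (act g x) = W +>\<^bsub>V\<^esub> \<phi> (act g y)"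
      using eq_iff[OF \<phi>[OF act_c[OF g x]] \<phi>[OF act_c[OF g y]]] by simp
  qed
  then show ?thesis
  proof (rule disj_forward)
    assume const: "\<forall>x\<in>\<Omega>. \<forall>y\<in>\<Omega>. W +>\<^bsub>V\<^esub> \<phi> x = W +>\<^bsub>V\<^esub> \<phi> y"
    show "\<forall>x\<in>\<Omega>. \<forall>y\<in>\<Omega>. \<phi> x \<ominus>\<^bsub>V\<^esub> \<phi> y \<in> W"
    proof (intro ballI)
      fix x y assume xy: "x \<in> \<Omega>" "y \<in> \<Omega>"
      then have "W +>\<^bsub>V\<^esub> \<phi> x = W +>\<^bsub>V\<^esub> \<phi> y" using const by blast
      then show "\<phi> x \<ominus>\<^bsub>V\<^esub> \<phi> y \<in> W" unfolding eq_iff[OF \<phi>[OF xy(1)] \<phi>[OF xy(2)]] .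
    qed
  qed
qed

section \<open>Representations of a non-cyclic primitive action\<close>

locale noncyclic_primitive_action =
  fixes F :: "('f, 'r) ring_scheme"
    and G :: "('g, 'm) monoid_scheme"
    and \<Omega> :: "'w set"
    and act :: "'g \<Rightarrow> 'w \<Rightarrow> 'w"
  assumes field: "field F"
    and group: "group G"
    and action: "group_action G \<Omega> act"
    and primitive: "primitive_action G \<Omega> act"
    and not_cyclic: "\<not> cyclic_group (induced_group G \<Omega> act)"
begin

abbreviation perm :: "('f, 'w \<Rightarrow> 'f) module" where
  "perm \<equiv> perm_module F \<Omega>"

text \<open>
  These turn out to be the submodules whose quotients afford the action, i.e. the kernels of the maps
  \<^const>\<open>perm_lift\<close> that belong to representations.
\<close>

definition admissible :: "('w \<Rightarrow> 'f) set \<Rightarrow> bool" where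
  "admissible U \<longleftrightarrow> FG_submodule F G perm (perm_rep F G \<Omega> act) U \<and> U \<noteq> carrier perm \<and> \<not> hyperplane F perm U"

lemma perm_vectorspace: "vectorspace F perm"
  using field by (rule vectorspace_perm_module)

lemma perm_action_rep: "action_rep F G \<Omega> act perm (perm_rep F G \<Omega> act) (perm_unit F \<Omega>)"
  using field group action by (rule action_rep_perm_module)

lemma two_points: obtains x y where "x \<in> \<Omega>" "y \<in> \<Omega>" "x \<noteq> y"
  using not_cyclic_imp_moved_point[OF action not_cyclic] by metis

lemma perm_unit_carrier: "perm_unit F \<Omega> ` \<Omega> \<subseteq> carrier perm"
  using perm_action_rep by (auto simp: action_rep_def)

text \<open>
  If the points were not separated modulo \<open>U\<close>, they would all be congruent modulo \<open>U\<close>, and \<open>U\<close> would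
  be a hyperplane.
\<close>

lemma admissible_quotient_affords:
  assumes "admissible U"
  shows "affords F G \<Omega> act (quotient_space perm U)"
proof -
  have U: "FG_submodule F G perm (perm_rep F G \<Omega> act) U" "U \<noteq> carrier perm" "\<not> hyperplane F perm U"
    using assms by (simp_all add: admissible_def)
  have sub: "submodule F U perm" using U(1) by (simp add: FG_submodule_def)
  have "\<not> (\<forall>x\<in>\<Omega>. \<forall>y\<in>\<Omega>. perm_unit F \<Omega> x \<ominus>\<^bsub>perm\<^esub> perm_unit F \<Omega> y \<in> U)"
  proof
    assume const: "\<forall>x\<in>\<Omega>. \<forall>y\<in>\<Omega>. perm_unit F \<Omega> x \<ominus>\<^bsub>perm\<^esub> perm_unit F \<Omega> y \<in> U"
    obtain x0 where x0: "x0 \<in> \<Omega>" by (rule two_points)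
    have "codim F perm U =o cone"
    proof (rule codim_one_of_congruent_generators(1)[OF perm_vectorspace sub U(2) perm_unit_carrier perm_unit_span[OF field]])
      show "perm_unit F \<Omega> x0 \<in> perm_unit F \<Omega> ` \<Omega>" using x0 by (rule imageI)
      show "x \<ominus>\<^bsub>perm\<^esub> perm_unit F \<Omega> x0 \<in> U" if "x \<in> perm_unit F \<Omega> ` \<Omega>" for x
        using that const x0 by blast
    qed
    then show False using U(3) sub by (simp add: hyperplane_def)
  qed
  then have "inj_on (\<lambda>\<omega>. U +>\<^bsub>perm\<^esub> perm_unit F \<Omega> \<omega>) \<Omega>"
    using primitive_quotient_dichotomy[OF action primitive perm_action_rep U(1)] by blast
  then obtain \<sigma> where
    "action_rep F G \<Omega> act (quotient_space perm U) \<sigma> (\<lambda>\<omega>. U +>\<^bsub>perm\<^esub> perm_unit F \<Omega> \<omega>)"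
    by (rule action_rep_quotient[OF group perm_action_rep U(1)])
  then show ?thesis unfolding affords_def by blast
qed

text \<open>
  \<open>U\<close> is the kernel of the linear extension of \<open>\<phi>\<close>. The quotient by \<open>U\<close> is isomorphic to the span of the
  image of \<open>\<phi>\<close>, so it affords the action, whence \<open>U\<close> is not a hyperplane, and its dimension is at
  most that of \<open>V\<close>, with a strict inequality if \<open>V\<close> is finite-dimensional and larger than the span.
\<close>

lemma exists_admissible_kernel:
  assumes rep: "action_rep F G \<Omega> act V \<rho> \<phi>"
  obtains U where "admissible U" "codim F perm U \<le>o vdim F V"
    "\<lbrakk>vdim F V <o natLeq; module.span F V (\<phi> ` \<Omega>) \<noteq> carrier V\<rbrakk> \<Longrightarrow> codim F perm U <o vdim F V"
proof -
  let ?T = "perm_lift F \<Omega> V \<phi>" and ?u = "perm_unit F \<Omega>"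
  define U where "U = {f \<in> carrier perm. ?T f = \<zero>\<^bsub>V\<^esub>}"
  let ?Q = "quotient_space perm U" and ?P = "\<lambda>f. U +>\<^bsub>perm\<^esub> f"
  have V: "vectorspace F V" and \<phi>: "\<phi> \<in> \<Omega> \<rightarrow> carrier V" and inj: "inj_on \<phi> \<Omega>"
    using rep by (simp_all add: action_rep_def)
  have T: "linear_map F perm V ?T" using V \<phi> by (rule linear_map_perm_lift)
  interpret T: linear_map F perm V ?T by (rule T)
  have T_unit: "?T (?u \<omega>) = \<phi> \<omega>" if "\<omega> \<in> \<Omega>" for \<omega> using V \<phi> that by (rule perm_lift_perm_unit)
  have unit: "?u \<omega> \<in> carrier perm" if "\<omega> \<in> \<Omega>" for \<omega> using perm_unit_carrier that by blast
  have sub: "submodule F U perm"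
    using T.ker_is_submodule unfolding T.ker_def U_def .
  have FG: "FG_submodule F G perm (perm_rep F G \<Omega> act) U"
    unfolding FG_submodule_def
  proof (intro conjI ballI)
    fix g f assume g: "g \<in> carrier G" and f: "f \<in> U"
    have fc: "f \<in> carrier perm" "?T f = \<zero>\<^bsub>V\<^esub>" using f by (simp_all add: U_def)
    have "?T (perm_rep F G \<Omega> act g f) = \<rho> g \<zero>\<^bsub>V\<^esub>"
      using perm_lift_equivariant[OF field group action rep g fc(1)] fc(2) by simp
    also have "\<dots> = \<zero>\<^bsub>V\<^esub>"
      by (rule mod_hom.f0_is_0[OF linear_map.axioms(3)[OF action_rep_linear[OF rep g]]])
    finally show "perm_rep F G \<Omega> act g f \<in> U"
      using perm_rep_closed[OF field group action g fc(1)] by (simp add: U_def)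
  qed (rule sub)
  note P = linear_map_quotient[OF perm_vectorspace sub] quotient_map_surj[OF perm_vectorspace sub]
  note P_zero = quotient_map_eq_zero_iff[OF perm_vectorspace sub]
  have ker: "?P f = \<zero>\<^bsub>?Q\<^esub>" if "f \<in> carrier perm" "?T f = \<zero>\<^bsub>V\<^esub>" for f
    using P_zero[OF that(1)] that by (simp add: U_def)
  have inj_quotient: "inj_on (\<lambda>\<omega>. ?P (?u \<omega>)) \<Omega>"
  proof (rule inj_onI)
    fix x y assume xy: "x \<in> \<Omega>" "y \<in> \<Omega>" "?P (?u x) = ?P (?u y)"
    then have "?u x \<ominus>\<^bsub>perm\<^esub> ?u y \<in> U"
      using quotient_map_eq_iff[OF perm_vectorspace sub unit[OF xy(1)] unit[OF xy(2)]] by simp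
    then have "?T (?u x \<ominus>\<^bsub>perm\<^esub> ?u y) = \<zero>\<^bsub>V\<^esub>" by (simp add: U_def)
    then have "\<phi> x \<ominus>\<^bsub>V\<^esub> \<phi> y = \<zero>\<^bsub>V\<^esub>"
      unfolding T.T_minus[OF unit[OF xy(1)] unit[OF xy(2)]] T_unit[OF xy(1)] T_unit[OF xy(2)] .
    then have "\<phi> x = \<phi> y"
      by (rule abelian_group.eq_of_minus_eq_zero[OF T.W.module.M.abelian_group_axioms
            funcset_mem[OF \<phi> xy(1)] funcset_mem[OF \<phi> xy(2)]])
    then show "x = y" by (rule inj_onD[OF inj _ xy(1,2)])
  qed
  obtain \<sigma> where \<sigma>: "action_rep F G \<Omega> act ?Q \<sigma> (\<lambda>\<omega>. ?P (?u \<omega>))"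
    using inj_quotient by (rule action_rep_quotient[OF group perm_action_rep FG])
  have "\<not> hyperplane F perm U"
    using not_one_dimensional_rep[OF group action primitive not_cyclic \<sigma>]
    by (simp add: hyperplane_def codim_def)
  moreover have "U \<noteq> carrier perm"
  proof
    assume all: "U = carrier perm"
    have zero: "\<phi> \<omega> = \<zero>\<^bsub>V\<^esub>" if \<omega>: "\<omega> \<in> \<Omega>" for \<omega>
    proof -
      have "?u \<omega> \<in> U" unfolding all using \<omega> by (rule unit)
      then have "?T (?u \<omega>) = \<zero>\<^bsub>V\<^esub>" by (simp add: U_def)
      then show ?thesis unfolding T_unit[OF \<omega>] .
    qed
    obtain x y where xy: "x \<in> \<Omega>" "y \<in> \<Omega>" "x \<noteq> y" by (rule two_points)
    have "\<phi> x = \<phi> y" using zero[OF xy(1)] zero[OF xy(2)] by simp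
    then show False using inj_onD[OF inj _ xy(1,2)] xy(3) by simp
  qed
  ultimately have adm: "admissible U" using FG by (simp add: admissible_def)
  have le: "codim F perm U \<le>o vdim F V"
    unfolding codim_def using P(1) T P(2) ker by (rule vdim_le_of_ker_le)
  have "codim F perm U <o vdim F V"
    if fin: "vdim F V <o natLeq" and not_span: "module.span F V (\<phi> ` \<Omega>) \<noteq> carrier V"
  proof -
    have \<phi>V: "\<phi> ` \<Omega> \<subseteq> carrier V" using \<phi> by blast
    interpret S: submodule F "module.span F V (\<phi> ` \<Omega>)" V
      using \<phi>V by (rule T.W.module.span_is_submodule)
    obtain y where y: "y \<in> carrier V" "y \<notin> module.span F V (\<phi> ` \<Omega>)"
      using not_span S.subset by blast
    show ?thesis
      unfolding codim_def
    proof (rule vdim_less_of_ker_le[OF P(1) T P(2) ker fin y(1)])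
      show "y \<noteq> \<zero>\<^bsub>V\<^esub>" using y(2) S.zero_closed by blast
      show "?P f = \<zero>\<^bsub>?Q\<^esub>" if f: "f \<in> carrier perm" "?T f = y" for f
      proof -
        \<comment> \<open>Modulo the span, \<open>?T\<close> vanishes on the unit vectors, hence everywhere.\<close>
        have "?T f \<in> module.span F V (\<phi> ` \<Omega>)"
        proof -
          let ?W = "module.span F V (\<phi> ` \<Omega>)"
          note subW = S.submodule_axioms
          obtain x0 where x0: "x0 \<in> \<Omega>" by (rule two_points)
          have zero: "?W +>\<^bsub>V\<^esub> ?T x = \<zero>\<^bsub>quotient_space V ?W\<^esub>" if x: "x \<in> ?u ` \<Omega>" for x
          proof -
            obtain \<omega> where \<omega>: "\<omega> \<in> \<Omega>" "x = ?u \<omega>" using x by blast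
            have "\<phi> \<omega> \<in> ?W" using T.W.module.in_own_span[OF \<phi>V] \<omega>(1) by blast
            then show ?thesis
              unfolding \<omega>(2) T_unit[OF \<omega>(1)]
              using quotient_map_eq_zero_iff[OF V subW funcset_mem[OF \<phi> \<omega>(1)]] by simp
          qed
          have x0u: "?u x0 \<in> ?u ` \<Omega>" using x0 by (rule imageI)
          have lin: "linear_map F V (quotient_space V ?W) (\<lambda>v. ?W +>\<^bsub>V\<^esub> v)"
            using V subW by (rule linear_map_quotient)
          have "\<exists>c\<in>carrier F. ?W +>\<^bsub>V\<^esub> ?T f = c \<odot>\<^bsub>quotient_space V ?W\<^esub> (?W +>\<^bsub>V\<^esub> ?T (?u x0))"
          proof (rule linear_map_in_line_of_const_on_span[OF linear_map_comp[OF T lin] perm_unit_carrier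
                perm_unit_span[OF field] x0u _ f(1)])
            show "?W +>\<^bsub>V\<^esub> ?T x = ?W +>\<^bsub>V\<^esub> ?T (?u x0)" if "x \<in> ?u ` \<Omega>" for x
              using zero[OF that] zero[OF x0u] by simp
          qed
          then obtain c where c: "c \<in> carrier F"
            "?W +>\<^bsub>V\<^esub> ?T f = c \<odot>\<^bsub>quotient_space V ?W\<^esub> \<zero>\<^bsub>quotient_space V ?W\<^esub>"
            unfolding zero[OF x0u] by blast
          interpret Q: vectorspace F "quotient_space V ?W"
            using V subW by (rule vectorspace_quotient_space)
          have "?W +>\<^bsub>V\<^esub> ?T f = \<zero>\<^bsub>quotient_space V ?W\<^esub>"
            unfolding c(2) using c(1) by (rule Q.smult_r_null)
          then show ?thesis
            using quotient_map_eq_zero_iff[OF V subW T.T_im[OF f(1)]] by simp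
        qed
        then show ?thesis using f(2) y(2) by simp
      qed
    qed
  qed
  then show thesis using that adm le by blast
qed

lemma LinDim_is_min:
  "is_min_card (LinDim F G \<Omega> act)
     {vdim F V | V :: ('f, ('w \<Rightarrow> 'f) set) module. affords F G \<Omega> act V}"
proof -
  let ?K = "{vdim F V | V :: ('f, ('w \<Rightarrow> 'f) set) module. affords F G \<Omega> act V}"
  obtain U where "admissible U" by (rule exists_admissible_kernel[OF perm_action_rep])
  then have "affords F G \<Omega> act (quotient_space perm U)" by (rule admissible_quotient_affords)
  then have "vdim F (quotient_space perm U) \<in> ?K" by blast
  then have ne: "?K \<noteq> {}" by (metis emptyE)
  have card: "\<forall>\<kappa>\<in>?K. Card_order \<kappa>"
  proof
    show "Card_order \<kappa>" if "\<kappa> \<in> ?K" for \<kappa> using that Card_order_vdim by auto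
  qed
  obtain \<kappa> where \<kappa>: "\<kappa> \<in> ?K" "\<forall>\<mu>\<in>?K. \<kappa> \<le>o \<mu>"
    using exists_minim_Card_order[OF ne card] by (elim bexE)
  have "\<kappa> =o \<kappa>" using card \<kappa>(1) by (intro ordIso_refl) (rule bspec)
  then have "is_min_card \<kappa> ?K"
    unfolding is_min_card_def using \<kappa>(1) by (intro conjI \<kappa>(2) bexI[of _ \<kappa>])
  then show ?thesis unfolding LinDim_def by (rule someI[of "\<lambda>\<kappa>. is_min_card \<kappa> ?K"])
qed

lemma LinDim_le_codim:
  assumes "admissible U"
  shows "LinDim F G \<Omega> act \<le>o codim F perm U"
  using LinDim_is_min admissible_quotient_affords[OF assms]
  unfolding is_min_card_def codim_def by blast

text \<open>
  Here the vectors of \<open>V\<close> may have any type: replacing \<open>V\<close> by a quotient of the permutation module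
  leads back to the type over which \<^const>\<open>LinDim\<close> minimises.
\<close>

lemma LinDim_le_vdim:
  assumes "affords F G \<Omega> act V"
  shows "LinDim F G \<Omega> act \<le>o vdim F V"
proof -
  obtain \<rho> \<phi> where "action_rep F G \<Omega> act V \<rho> \<phi>" using assms by (auto simp: affords_def)
  then obtain U where "admissible U" "codim F perm U \<le>o vdim F V"
    by (rule exists_admissible_kernel)
  then show ?thesis using LinDim_le_codim ordLeq_transitive by blast
qed

lemma LinDim_is_min_codim:
  "is_min_card (LinDim F G \<Omega> act) {codim F perm U | U. admissible U}"
proof -
  obtain V :: "('f, ('w \<Rightarrow> 'f) set) module" where
    V: "affords F G \<Omega> act V" "LinDim F G \<Omega> act =o vdim F V"
    using LinDim_is_min unfolding is_min_card_def by blast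
  obtain \<rho> \<phi> where "action_rep F G \<Omega> act V \<rho> \<phi>" using V(1) by (auto simp: affords_def)
  then obtain U where U: "admissible U" "codim F perm U \<le>o vdim F V"
    by (rule exists_admissible_kernel)
  have "codim F perm U \<le>o LinDim F G \<Omega> act"
    using U(2) ordIso_symmetric[OF V(2)] by (rule ordLeq_ordIso_trans)
  then have "LinDim F G \<Omega> act =o codim F perm U"
    using LinDim_le_codim[OF U(1)] by (simp add: ordIso_iff_ordLeq)
  then show ?thesis unfolding is_min_card_def using U(1) LinDim_le_codim by blast
qed

text \<open>
  The span of the image of \<open>\<phi>\<close> affords the action by itself, so a finite minimum forces it to be all
  of \<open>V\<close>.
\<close>

lemma witness_span:
  assumes "witness F G \<Omega> act V \<rho> \<phi>" "LinDim F G \<Omega> act <o natLeq"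
  shows "vdim F V <o natLeq" and "module.span F V (\<phi> ` \<Omega>) = carrier V"
proof -
  have rep: "action_rep F G \<Omega> act V \<rho> \<phi>" and eq: "vdim F V =o LinDim F G \<Omega> act"
    using assms(1) by (simp_all add: witness_def)
  show fin: "vdim F V <o natLeq" using eq assms(2) by (rule ordIso_ordLess_trans)
  obtain U where U: "admissible U"
    "\<lbrakk>vdim F V <o natLeq; module.span F V (\<phi> ` \<Omega>) \<noteq> carrier V\<rbrakk> \<Longrightarrow> codim F perm U <o vdim F V"
    using exists_admissible_kernel[OF rep] by metis
  show "module.span F V (\<phi> ` \<Omega>) = carrier V"
  proof (rule ccontr)
    assume "module.span F V (\<phi> ` \<Omega>) \<noteq> carrier V"
    with fin have "codim F perm U <o vdim F V" by (rule U(2))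
    then have "codim F perm U <o LinDim F G \<Omega> act" using eq by (rule ordLess_ordIso_trans)
    then show False using LinDim_le_codim[OF U(1)] not_ordLess_ordLeq by blast
  qed
qed

text \<open>
  Otherwise the points would be separated modulo \<open>W\<close>, and \<open>V / W\<close>, which has smaller finite dimension
  than \<open>V\<close>, would afford the action.
\<close>

lemma witness_submodule_congruences:
  assumes wit: "witness F G \<Omega> act V \<rho> \<phi>" and fin: "LinDim F G \<Omega> act <o natLeq"
    and W: "nonzero_proper_FG_submodule F G V \<rho> W" and xy: "x \<in> \<Omega>" "y \<in> \<Omega>"
  shows "\<phi> x \<ominus>\<^bsub>V\<^esub> \<phi> y \<in> W"
proof (rule ccontr)
  assume contr: "\<phi> x \<ominus>\<^bsub>V\<^esub> \<phi> y \<notin> W"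
  have rep: "action_rep F G \<Omega> act V \<rho> \<phi>" and eq: "vdim F V =o LinDim F G \<Omega> act"
    using wit by (simp_all add: witness_def)
  have V: "vectorspace F V" using rep by (simp add: action_rep_def)
  have FG: "FG_submodule F G V \<rho> W" and ne: "W \<noteq> {\<zero>\<^bsub>V\<^esub>}"
    using W by (simp_all add: nonzero_proper_FG_submodule_def)
  have sub: "submodule F W V" using FG by (simp add: FG_submodule_def)
  have "inj_on (\<lambda>\<omega>. W +>\<^bsub>V\<^esub> \<phi> \<omega>) \<Omega>"
    using primitive_quotient_dichotomy[OF action primitive rep FG] contr xy by blast
  then obtain \<sigma> where "action_rep F G \<Omega> act (quotient_space V W) \<sigma> (\<lambda>\<omega>. W +>\<^bsub>V\<^esub> \<phi> \<omega>)"
    by (rule action_rep_quotient[OF group rep FG])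
  then have "affords F G \<Omega> act (quotient_space V W)" unfolding affords_def by blast
  then have le: "LinDim F G \<Omega> act \<le>o codim F V W" unfolding codim_def by (rule LinDim_le_vdim)
  have "codim F V W <o vdim F V"
    using V witness_span(1)[OF wit fin] sub ne by (rule codim_less_vdim)
  then have "codim F V W <o LinDim F G \<Omega> act" using eq by (rule ordLess_ordIso_trans)
  then show False using le not_ordLess_ordLeq by blast
qed

text \<open>
  All vectors \<open>\<phi> x\<close> are congruent modulo \<open>W \<inter> W'\<close>, so that every \<open>w\<close> is congruent to a multiple
  \<open>c \<cdot> \<phi> x0\<close> modulo \<open>W \<inter> W'\<close>. For \<open>w \<in> W\<close> this multiple lies in \<open>W\<close>, but \<open>\<phi> x0\<close> does not; hence
  \<open>c = 0\<close> and \<open>w \<in> W'\<close>.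
\<close>

lemma witness_submodule_subset:
  assumes wit: "witness F G \<Omega> act V \<rho> \<phi>" and fin: "LinDim F G \<Omega> act <o natLeq"
    and W: "nonzero_proper_FG_submodule F G V \<rho> W" and W': "nonzero_proper_FG_submodule F G V \<rho> W'"
  shows "W \<subseteq> W'"
proof
  fix w assume w: "w \<in> W"
  have rep: "action_rep F G \<Omega> act V \<rho> \<phi>" using wit by (simp add: witness_def)
  have V: "vectorspace F V" and \<phi>: "\<phi> \<in> \<Omega> \<rightarrow> carrier V" using rep by (simp_all add: action_rep_def)
  interpret V: vectorspace F V by (rule V)
  note span = witness_span(2)[OF wit fin]
  have sub: "submodule F W V" "W \<noteq> carrier V" and sub': "submodule F W' V" "W' \<noteq> carrier V"
    using W W' by (simp_all add: nonzero_proper_FG_submodule_def FG_submodule_def)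
  interpret W: submodule F W V by (rule sub)
  interpret W': submodule F W' V by (rule sub')
  obtain x0 where x0: "x0 \<in> \<Omega>" by (rule two_points)
  have \<phi>V: "\<phi> ` \<Omega> \<subseteq> carrier V" using \<phi> by blast
  have \<phi>0: "\<phi> x0 \<in> \<phi> ` \<Omega>" using x0 by (rule imageI)
  have inter: "submodule F (W \<inter> W') V"
    using W.subset by (intro LinearCombinations.submodule.intro V.module_axioms) auto
  have proper: "W \<inter> W' \<noteq> carrier V" using sub(2) W.subset by blast
  have cong: "x \<ominus>\<^bsub>V\<^esub> \<phi> x0 \<in> W" "x \<ominus>\<^bsub>V\<^esub> \<phi> x0 \<in> W \<inter> W'" if "x \<in> \<phi> ` \<Omega>" for x
    using that x0 witness_submodule_congruences[OF wit fin W] witness_submodule_congruences[OF wit fin W']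
    by auto
  have wc: "w \<in> carrier V" using w W.subset by blast
  obtain c where c: "c \<in> carrier F" "w \<ominus>\<^bsub>V\<^esub> (c \<odot>\<^bsub>V\<^esub> \<phi> x0) \<in> W \<inter> W'"
    using codim_one_of_congruent_generators(3)[OF V inter proper \<phi>V span \<phi>0 cong(2) wc] by blast
  have \<phi>0c: "\<phi> x0 \<in> carrier V" using \<phi> x0 by (rule funcset_mem)
  have cx: "c \<odot>\<^bsub>V\<^esub> \<phi> x0 \<in> carrier V" using c(1) \<phi>0c by (rule V.smult_closed)
  have "w \<ominus>\<^bsub>V\<^esub> (w \<ominus>\<^bsub>V\<^esub> (c \<odot>\<^bsub>V\<^esub> \<phi> x0)) \<in> W"
    using submodule_minus_closed[OF V sub(1) w] c(2) by blast
  also have "w \<ominus>\<^bsub>V\<^esub> (w \<ominus>\<^bsub>V\<^esub> (c \<odot>\<^bsub>V\<^esub> \<phi> x0)) = c \<odot>\<^bsub>V\<^esub> \<phi> x0"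
    using wc cx by (simp add: a_minus_def V.M.minus_add V.M.r_neg2)
  finally have cW: "c \<odot>\<^bsub>V\<^esub> \<phi> x0 \<in> W" .
  have "c = \<zero>\<^bsub>F\<^esub>"
  proof (rule ccontr)
    assume "c \<noteq> \<zero>\<^bsub>F\<^esub>"
    then have "\<phi> x0 = inv\<^bsub>F\<^esub> c \<odot>\<^bsub>V\<^esub> (c \<odot>\<^bsub>V\<^esub> \<phi> x0)"
      using V.mult_inverse[OF c(1) \<phi>0c refl] by blast
    moreover have "inv\<^bsub>F\<^esub> c \<in> carrier F" using c(1) \<open>c \<noteq> \<zero>\<^bsub>F\<^esub>\<close> by (rule V.inverse_exists)
    ultimately have "\<phi> x0 \<in> W" using W.smult_closed[OF _ cW] by metis
    then show False
      using codim_one_of_congruent_generators(2)[OF V sub \<phi>V span \<phi>0 cong(1)] by blast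
  qed
  then have "w \<ominus>\<^bsub>V\<^esub> \<zero>\<^bsub>V\<^esub> \<in> W'" using c(2) V.smult_l_null[OF \<phi>0c] by simp
  moreover have "\<ominus>\<^bsub>V\<^esub> \<zero>\<^bsub>V\<^esub> = \<zero>\<^bsub>V\<^esub>" by (rule V.M.minus_equality) simp_all
  ultimately show "w \<in> W'" using wc by (simp add: a_minus_def)
qed

lemma witness_submodule_codim:
  assumes wit: "witness F G \<Omega> act V \<rho> \<phi>" and fin: "LinDim F G \<Omega> act <o natLeq"
    and W: "nonzero_proper_FG_submodule F G V \<rho> W"
  shows "codim F V W =o cone"
proof -
  have V: "vectorspace F V" and \<phi>: "\<phi> \<in> \<Omega> \<rightarrow> carrier V"
    using wit by (simp_all add: witness_def action_rep_def)
  have sub: "submodule F W V" "W \<noteq> carrier V"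
    using W by (simp_all add: nonzero_proper_FG_submodule_def FG_submodule_def)
  obtain x0 where x0: "x0 \<in> \<Omega>" by (rule two_points)
  have \<phi>V: "\<phi> ` \<Omega> \<subseteq> carrier V" using \<phi> by blast
  have \<phi>0: "\<phi> x0 \<in> \<phi> ` \<Omega>" using x0 by (rule imageI)
  show ?thesis
  proof (rule codim_one_of_congruent_generators(1)[OF V sub \<phi>V witness_span(2)[OF wit fin] \<phi>0])
    show "x \<ominus>\<^bsub>V\<^esub> \<phi> x0 \<in> W" if "x \<in> \<phi> ` \<Omega>" for x
      using that x0 witness_submodule_congruences[OF wit fin W] by auto
  qed
qed

end

theorem theorem1p1:
  fixes F :: "('f, 'r) ring_scheme"
    and G :: "('g, 'm) monoid_scheme"
    and \<Omega> :: "'w set"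
    and act :: "'g \<Rightarrow> 'w \<Rightarrow> 'w"
  assumes "field F"
    and "group G"
    and "group_action G \<Omega> act"
    and "primitive_action G \<Omega> act"
    and "\<not> cyclic_group (induced_group G \<Omega> act)"
  shows "(\<forall>V :: ('f, 'v) module. affords F G \<Omega> act V \<longrightarrow> LinDim F G \<Omega> act \<le>o vdim F V) \<and>
    is_min_card (LinDim F G \<Omega> act)
      {codim F (perm_module F \<Omega>) U | U.
         FG_submodule F G (perm_module F \<Omega>) (perm_rep F G \<Omega> act) U \<and>
         U \<noteq> carrier (perm_module F \<Omega>) \<and>
         \<not> hyperplane F (perm_module F \<Omega>) U} \<and>
    (LinDim F G \<Omega> act <o natLeq \<longrightarrow>
      (\<forall>(V :: ('f, 'v) module) \<rho> \<phi>. witness F G \<Omega> act V \<rho> \<phi> \<and> reducible F G V \<rho> \<longrightarrow>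
        (\<exists>W. nonzero_proper_FG_submodule F G V \<rho> W \<and>
             (\<forall>W'. nonzero_proper_FG_submodule F G V \<rho> W' \<longrightarrow> W' = W) \<and>
             codim F V W =o cone)))"
proof -
  interpret noncyclic_primitive_action F G \<Omega> act
    using assms by (rule noncyclic_primitive_action.intro)
  have "\<exists>W. nonzero_proper_FG_submodule F G V \<rho> W \<and>
      (\<forall>W'. nonzero_proper_FG_submodule F G V \<rho> W' \<longrightarrow> W' = W) \<and> codim F V W =o cone"
    if fin: "LinDim F G \<Omega> act <o natLeq" and wit: "witness F G \<Omega> act V \<rho> \<phi>"
      and red: "reducible F G V \<rho>"
    for V :: "('f, 'v) module" and \<rho> \<phi>
  proof -
    obtain W where W: "nonzero_proper_FG_submodule F G V \<rho> W"
      using red by (auto simp: reducible_def)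
    have "W' = W" if "nonzero_proper_FG_submodule F G V \<rho> W'" for W'
      using witness_submodule_subset[OF wit fin W that] witness_submodule_subset[OF wit fin that W]
      by blast
    then show ?thesis using W witness_submodule_codim[OF wit fin W] by blast
  qed
  then show ?thesis
    using LinDim_le_vdim LinDim_is_min_codim unfolding admissible_def by blast
qed

end
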